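(* Let $d,n,d_{\mathrm{eff}}\ge1$ be integers with $d_{\mathrm{eff}}<d$. There is a constant $C_5(d,n)>0$, which may depend on $d$ and $n$ but not on $\epsilon$, such that for every $\epsilon\in(0,1)$ and every function $f$ with $\|f\|_{W^{n,\infty}([0,1]^d)}\le1$, where $x$ is restricted to $\bar\chi^d_{d_{\mathrm{eff}}}$, there exists a bi-activation feed-forward network $M_{\mathcal C_M}$ with at most $\mathcal C_M=C_5(d,n)\,\epsilon^{-d_{\mathrm{eff}}/n}$ parameters $a\in\mathbb R^{\mathcal C_M}$ for which the error restricted to $\bar\chi^d_{d_{\mathrm{eff}}}$ satisfies $$\min_{a\in\mathbb R^{\mathcal C_M}}\ \max_{x\in\bar\chi^d_{d_{\mathrm{eff}}}}\ |f(x)-M_{\mathcal C_M}(a)(x)|\le\epsilon .$$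
   Context: Canonical subspaces: let $I^d_{d_{\mathrm{eff}}}$ be the collection of all subsets $e\subset\{1,\dots,d\}$ with exactly $d_{\mathrm{eff}}$ elements. For $e\in I^d_{d_{\mathrm{eff}}}$ put $\chi^d_{d_{\mathrm{eff}},e}=\{x\in[0,1]^d:\ x_i=0\text{ for all } i\notin e\}$, and let $\bar\chi^d_{d_{\mathrm{eff}}}=\bigcup_{e\in I^d_{d_{\mathrm{eff}}}}\chi^d_{d_{\mathrm{eff}},e}$ be the union of all $\binom{d}{d_{\mathrm{eff}}}$ of them. Sobolev norm: $\|f\|_{W^{n,\infty}([0,1]^d)}=\max_{\mathbf n:|\mathbf n|\le n}\operatorname{ess\,sup}_{x\in[0,1]^d}|D^{\mathbf n}f(x)|$, where $\mathbf n=(n_1,\dots,n_d)\in\{0,1,\dots\}^d$, $|\mathbf n|=\sum_{i=1}^d n_i$, and $D^{\mathbf n}f$ is the corresponding weak derivative. Since $n\ge1$, $f$ is identified with its continuous representative. Bi-activation feed-forward network: a function of the input $x\in\mathbb R^d$ computed by $h_0=x$, $h_{i+1}=\sigma_i(W_ih_i+b_i)$ for successive hidden layers $i$, followed by an affine output layer, where $W_i$ are (possibly sparse) weight matrices, $b_i$ are bias vectors, and each $\sigma_i$ acts coordinatewise and is either $\mathrm{ReLU}(t)=\max\{0,t\}$ or $t\mapsto t^2$, the choice depending on the layer. The network (number of layers, widths, which connections are present, and which activation is used in each layer) is a fixed architecture; its parameters $a$ are the weights of the connections that are present and the biases, and the number of parameters counts only these. $M(a)(x)$ denotes the output on input $x$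 when the parameters are $a$. The bound "$\min_a\max_x\cdots\le\epsilon$" means that some choice of the parameters $a$ attains uniform error at most $\epsilon$ on the indicated set. *)

theory Defs
  imports "HOL-Analysis.Analysis" "HOL-Probability.Essential_Supremum"
begin

text \<open>Dimension \<open>d\<close> is the cardinality of the index type \<open>'d\<close>. The closed unit cube is
  \<open>cbox 0 1\<close> and its interior is \<open>box 0 1\<close>, where \<open>1\<close> is the all-ones vector.\<close>

definition canonical_index :: "nat \<Rightarrow> 'd::finite set set" where
  "canonical_index k = {e. card e = k}"

definition canonical_subspace :: "'d::finite set \<Rightarrow> (real ^ 'd) set" where
  "canonical_subspace e = {x \<in> cbox 0 1. \<forall>i. i \<notin> e \<longrightarrow> x $ i = 0}"

definition canonical_union :: "nat \<Rightarrow> (real ^ 'd::finite) set" where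
  "canonical_union k = (\<Union>e \<in> canonical_index k. canonical_subspace e)"

definition partial :: "'d::finite \<Rightarrow> (real ^ 'd \<Rightarrow> real) \<Rightarrow> real ^ 'd \<Rightarrow> real" where
  "partial i \<phi> = (\<lambda>x. frechet_derivative \<phi> (at x) (axis i 1))"

definition partials :: "'d::finite list \<Rightarrow> (real ^ 'd \<Rightarrow> real) \<Rightarrow> real ^ 'd \<Rightarrow> real" where
  "partials is \<phi> = foldr partial is \<phi>"

text \<open>Infinite differentiability: every iterated partial derivative is (Frechet) differentiable
  everywhere, and hence also continuous.\<close>

definition smooth :: "(real ^ 'd::finite \<Rightarrow> real) \<Rightarrow> bool" where
  "smooth \<phi> \<longleftrightarrow> (\<forall>is. partials is \<phi> differentiable_on UNIV)"

definition test_function :: "(real ^ 'd::finite \<Rightarrow> real) \<Rightarrow> bool" where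
  "test_function \<phi> \<longleftrightarrow>
     smooth \<phi> \<and> compact (closure {x. \<phi> x \<noteq> 0}) \<and> closure {x. \<phi> x \<noteq> 0} \<subseteq> box 0 1"

text \<open>A multi-index is a function \<open>\<alpha> :: 'd \<Rightarrow> nat\<close>. The classical derivative of order \<open>\<alpha>\<close>
  differentiates \<open>\<alpha> i\<close> times in direction \<open>i\<close>; it is only applied to smooth functions, where
  the order in which the directions are taken is irrelevant.\<close>

definition mi_order :: "('d::finite \<Rightarrow> nat) \<Rightarrow> nat" where
  "mi_order \<alpha> = (\<Sum>i\<in>UNIV. \<alpha> i)"

definition classical_D :: "('d::finite \<Rightarrow> nat) \<Rightarrow> (real ^ 'd \<Rightarrow> real) \<Rightarrow> real ^ 'd \<Rightarrow> real" where
  "classical_D \<alpha> \<phi> = partials (SOME is. \<forall>i. count_list is i = \<alpha> i) \<phi>"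

definition locally_integrable :: "(real ^ 'd::finite \<Rightarrow> real) \<Rightarrow> bool" where
  "locally_integrable f \<longleftrightarrow>
     (\<forall>K. compact K \<longrightarrow> K \<subseteq> box 0 1 \<longrightarrow> f absolutely_integrable_on K)"

definition has_weak_D ::
  "('d::finite \<Rightarrow> nat) \<Rightarrow> (real ^ 'd \<Rightarrow> real) \<Rightarrow> (real ^ 'd \<Rightarrow> real) \<Rightarrow> bool" where
  "has_weak_D \<alpha> f g \<longleftrightarrow> locally_integrable f \<and> locally_integrable g \<and>
     (\<forall>\<phi>. test_function \<phi> \<longrightarrow>
        (LINT x:box 0 1|lebesgue. f x * classical_D \<alpha> \<phi> x) =
        (-1) ^ mi_order \<alpha> * (LINT x:box 0 1|lebesgue. g x * \<phi> x))"

text \<open>Weak derivatives are unique up to null sets, so the choice of the representative does not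
  affect the essential suprema below.\<close>

definition weak_D :: "('d::finite \<Rightarrow> nat) \<Rightarrow> (real ^ 'd \<Rightarrow> real) \<Rightarrow> real ^ 'd \<Rightarrow> real" where
  "weak_D \<alpha> f = (SOME g. has_weak_D \<alpha> f g)"

text \<open>The norm is \<open>\<infinity>\<close> exactly for the functions outside the Sobolev space.\<close>

definition sobolev_norm :: "nat \<Rightarrow> (real ^ 'd::finite \<Rightarrow> real) \<Rightarrow> ereal" where
  "sobolev_norm n f =
     (if \<forall>\<alpha>. mi_order \<alpha> \<le> n \<longrightarrow> (\<exists>g. has_weak_D \<alpha> f g)
      then MAX \<alpha> \<in> {\<alpha>. mi_order \<alpha> \<le> n}.
             esssup (restrict_space lebesgue (cbox 0 1)) (\<lambda>x. ereal \<bar>weak_D \<alpha> f x\<bar>)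
      else \<infinity>)"

datatype activation = ReLU | Square

fun activate :: "activation \<Rightarrow> real \<Rightarrow> real" where
  "activate ReLU t = max 0 t"
| "activate Square t = t\<^sup>2"

text \<open>Layer \<open>0\<close> is the input, layers \<open>1, \<dots>, depth\<close> are the hidden layers and layer \<open>depth + 1\<close> is
  the affine output layer. The neurons of layer \<open>l\<close> are \<open>{..<width l}\<close>, the set \<open>links l\<close>
  consists of the connections present from layer \<open>l\<close> to layer \<open>l + 1\<close>, and \<open>activ l\<close> is the
  activation of hidden layer \<open>l + 1\<close>.\<close>

record architecture =
  depth :: nat
  width :: "nat \<Rightarrow> nat"
  links :: "nat \<Rightarrow> (nat \<times> nat) set"
  activ :: "nat \<Rightarrow> activation"

definition is_architecture :: "nat \<Rightarrow> architecture \<Rightarrow> bool" where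
  "is_architecture d A \<longleftrightarrow> width A 0 = d \<and> width A (Suc (depth A)) = 1 \<and>
     (\<forall>l \<le> depth A. links A l \<subseteq> {..<width A l} \<times> {..<width A (Suc l)})"

text \<open>Parameters are indexed by slots: \<open>Weight l i j\<close> belongs to the connection from neuron \<open>i\<close> of
  layer \<open>l\<close> to neuron \<open>j\<close> of layer \<open>l + 1\<close>, and \<open>Bias l j\<close> to neuron \<open>j\<close> of layer \<open>l + 1\<close>.
  A parameter vector assigns a real to every slot; the values at slots outside \<open>slots A\<close> are
  never used.\<close>

datatype slot = Weight nat nat nat | Bias nat nat

definition slots :: "architecture \<Rightarrow> slot set" where
  "slots A = {Weight l i j | l i j. l \<le> depth A \<and> (i, j) \<in> links A l} \<union>
             {Bias l j | l j. l \<le> depth A \<and> j < width A (Suc l)}"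

definition num_params :: "architecture \<Rightarrow> nat" where
  "num_params A = card (slots A)"

definition affine_layer ::
  "architecture \<Rightarrow> (slot \<Rightarrow> real) \<Rightarrow> nat \<Rightarrow> (nat \<Rightarrow> real) \<Rightarrow> nat \<Rightarrow> real" where
  "affine_layer A a l h j = (\<Sum>i \<in> {i. (i, j) \<in> links A l}. a (Weight l i j) * h i) + a (Bias l j)"

fun hidden :: "architecture \<Rightarrow> (slot \<Rightarrow> real) \<Rightarrow> (nat \<Rightarrow> real) \<Rightarrow> nat \<Rightarrow> nat \<Rightarrow> real" where
  "hidden A a h 0 = h"
| "hidden A a h (Suc l) = (\<lambda>j. activate (activ A l) (affine_layer A a l (hidden A a h l) j))"

text \<open>The input neurons are the coordinates, numbered by an arbitrary fixed enumeration of the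
  finite index type.\<close>

definition input_layer :: "real ^ 'd::finite \<Rightarrow> nat \<Rightarrow> real" where
  "input_layer x j = x $ from_nat_into (UNIV :: 'd set) j"

definition network :: "architecture \<Rightarrow> (slot \<Rightarrow> real) \<Rightarrow> real ^ 'd::finite \<Rightarrow> real" where
  "network A a x = affine_layer A a (depth A) (hidden A a (input_layer x) (depth A)) 0"

end

theory Submission
  imports Defs
begin

text \<open>Mollifying \<open>f\<close> gives smooth functions whose derivatives of order at most \<open>n\<close> are bounded by the
  norm of \<open>f\<close>, so Taylor's theorem approximates \<open>f\<close> near each point of a grid of mesh \<open>1 / N\<close> by a
  polynomial of degree less than \<open>n\<close>, up to an error of order \<open>N\<close> to the power \<open>-n\<close>. These polynomials
  are glued with tensor products of hat functions. On the union of the canonical subspaces only the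
  grid points lying in that union contribute, which leaves of the order of \<open>N\<close> to the power \<open>d_eff\<close>
  terms. Each term is computed exactly by a network of constant size: one ReLU layer produces the
  hats and the coordinates, and square layers multiply them by
  \<open>4 * u * v = (u + v)\<^sup>2 - (u - v)\<^sup>2\<close>.\<close>

section \<open>Smooth bump functions\<close>

text \<open>Only weak derivatives of \<open>f\<close> are bounded, so Taylor's theorem cannot be
  applied to \<open>f\<close> itself. Testing a weak derivative against a translate of a nonnegative
  kernel bounds the classical derivatives of the mollification by the mass of the kernel, however
  narrow the kernel is. Its width may therefore depend on \<open>f\<close> and on the wanted
  accuracy: it enters the coefficients of the polynomials only, never the size of the network. That
  size is governed by the number of grid points alone, because the square activation makes products
  exact and no accuracy has to be bought there. For the count to be linear in the number of grid
  points, every neuron must read a bounded number of others, which is why fan-in is tracked along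
  with width. All terms get the same depth, so that they fit side by side into layers with one
  activation each.\<close>

definition derivative_chain :: "(nat \<Rightarrow> real \<Rightarrow> real) \<Rightarrow> bool" where
  "derivative_chain r \<longleftrightarrow> (\<forall>k t. (r k has_real_derivative r (Suc k) t) (at t))"

text \<open>In a set closed under differentiation, derivatives can be chosen again and again without
  leaving it. A property shared by the members, such as vanishing outside an interval, thus passes
  to all derivatives at once.\<close>

lemma derivative_chain_exists:
  assumes "u \<in> S"
    and closed: "\<And>u. u \<in> S \<Longrightarrow> \<exists>v\<in>S. \<forall>t. (u has_real_derivative v t) (at t)"
  obtains r where "derivative_chain r" "r 0 = u" "\<And>k. r k \<in> S"
proof -
  have "\<forall>u\<in>S. \<exists>v. v \<in> S \<and> (\<forall>t. (u has_real_derivative v t) (at t))"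
    using closed by blast
  from bchoice[OF this] obtain \<D>
    where \<D>: "\<And>u. u \<in> S \<Longrightarrow> \<D> u \<in> S \<and> (\<forall>t. (u has_real_derivative \<D> u t) (at t))"
    by blast
  define r where "r k = (\<D> ^^ k) u" for k
  have "r k \<in> S" for k
    by (induction k) (use \<open>u \<in> S\<close> \<D> in \<open>auto simp: r_def\<close>)
  with \<D> that[of r] show thesis
    by (simp add: derivative_chain_def r_def)
qed

text \<open>\<open>flat_exp 0\<close> is the standard flat function exp (-1/t) extended by 0; the
  powers of 1/t are the factors that its derivatives produce.\<close>

definition flat_exp :: "nat \<Rightarrow> real \<Rightarrow> real" where
  "flat_exp k t = (if t > 0 then (1 / t) ^ k * exp (- (1 / t)) else 0)"

lemma flat_exp_has_derivative:
  "(flat_exp k has_real_derivative flat_exp (k + 2) t - real k * flat_exp (Suc k) t) (at t)"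
proof -
  consider "t > 0" | "t < 0" | "t = 0" by linarith
  then show ?thesis
  proof cases
    case 1
    have inv: "((\<lambda>t. 1 / t) has_real_derivative - ((1 / t) * (1 / t))) (at t)"
      using 1 by (auto intro!: derivative_eq_intros)
    have "((\<lambda>t. (1 / t) ^ k) has_real_derivative - (real k * (1 / t) ^ Suc k)) (at t)"
    proof (induction k)
      case (Suc k)
      show ?case
        using DERIV_mult[OF inv Suc] by (simp add: algebra_simps add_divide_distrib)
    qed simp
    then have "((\<lambda>t. (1 / t) ^ k * exp (- (1 / t))) has_real_derivative
        (1 / t) ^ (k + 2) * exp (- (1 / t)) - real k * ((1 / t) ^ Suc k * exp (- (1 / t)))) (at t)"
      by (rule DERIV_cong[OF DERIV_mult[OF _ DERIV_fun_exp[OF DERIV_minus[OF inv]]]])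
         (simp add: algebra_simps)
    then have "(flat_exp k has_real_derivative
        (1 / t) ^ (k + 2) * exp (- (1 / t)) - real k * ((1 / t) ^ Suc k * exp (- (1 / t)))) (at t)"
      by (rule has_field_derivative_transform_within_open[of _ _ _ "{0<..}"])
         (use 1 in \<open>auto simp: flat_exp_def\<close>)
    then show ?thesis using 1 by (simp add: flat_exp_def)
  next
    case 2
    have "((\<lambda>t. 0) has_real_derivative 0) (at t)" by simp
    then have "(flat_exp k has_real_derivative 0) (at t)"
      by (rule has_field_derivative_transform_within_open[of _ _ _ "{..<0}"])
         (use 2 in \<open>auto simp: flat_exp_def\<close>)
    then show ?thesis using 2 by (simp add: flat_exp_def)
  next
    case 3
    \<comment> \<open>In terms of 1/t the difference quotient at 0 is a power divided by an
      exponential.\<close>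
    have "((\<lambda>t. (inverse t) ^ Suc k / exp (inverse t)) \<longlongrightarrow> 0) (at_right (0::real))"
      by (rule filterlim_compose[OF tendsto_power_div_exp_0 filterlim_inverse_at_top_right])
    moreover have "\<forall>\<^sub>F t in at_right (0::real). (inverse t) ^ Suc k / exp (inverse t) = flat_exp k t / t"
      by (auto simp: eventually_at_right_less flat_exp_def exp_minus divide_simps
            intro!: eventually_mono[OF eventually_at_right_less])
    ultimately have "((\<lambda>t. flat_exp k t / t) \<longlongrightarrow> 0) (at_right 0)"
      by (rule Lim_transform_eventually)
    moreover have "((\<lambda>t. flat_exp k t / t) \<longlongrightarrow> 0) (at_left 0)"
      by (rule Lim_transform_eventually[OF tendsto_const])
         (auto simp: flat_exp_def eventually_at_left_field intro!: exI[of _ "-1"])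
    ultimately have "((\<lambda>t. flat_exp k t / t) \<longlongrightarrow> 0) (at 0)"
      by (simp add: filterlim_at_split)
    then show ?thesis
      using 3 by (simp add: has_field_derivative_iff flat_exp_def)
  qed
qed

text \<open>Contains the bump exp (-1/(1+t)) * exp (-1/(1-t)) and is closed under differentiation:
  the reflected argument 1 - t brings in a minus sign, so multiples and differences suffice.\<close>

inductive_set bump_span :: "(real \<Rightarrow> real) set" where
  base: "(\<lambda>t. flat_exp i (1 + t) * flat_exp j (1 - t)) \<in> bump_span"
| scale: "u \<in> bump_span \<Longrightarrow> (\<lambda>t. c * u t) \<in> bump_span"
| diff: "u \<in> bump_span \<Longrightarrow> v \<in> bump_span \<Longrightarrow> (\<lambda>t. u t - v t) \<in> bump_span"

lemma bump_span_derivative: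
  "u \<in> bump_span \<Longrightarrow> \<exists>v\<in>bump_span. \<forall>t. (u has_real_derivative v t) (at t)"
proof (induction rule: bump_span.induct)
  case (base i j)
  let ?e = "\<lambda>i j t. flat_exp i (1 + t) * flat_exp j (1 - t)"
  let ?v = "\<lambda>t. (?e (i + 2) j t - real i * ?e (Suc i) j t)
               - (?e i (j + 2) t - real j * ?e i (Suc j) t)"
  have "?v \<in> bump_span"
    by (intro bump_span.intros)
  moreover have "(?e i j has_real_derivative ?v t) (at t)" for t
    by (rule derivative_eq_intros refl DERIV_chain2[OF flat_exp_has_derivative])+
       (simp add: algebra_simps)
  ultimately show ?case by (intro bexI[of _ ?v] allI)
next
  case (scale u c)
  then obtain v where "v \<in> bump_span" "\<forall>t. (u has_real_derivative v t) (at t)"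
    by blast
  then show ?case
    by (intro bexI[of _ "\<lambda>t. c * v t"] allI DERIV_cmult bump_span.scale) auto
next
  case (diff u v)
  then obtain u' v' where "u' \<in> bump_span" "\<forall>t. (u has_real_derivative u' t) (at t)"
    "v' \<in> bump_span" "\<forall>t. (v has_real_derivative v' t) (at t)"
    by blast
  then show ?case
    by (intro bexI[of _ "\<lambda>t. u' t - v' t"] allI DERIV_diff bump_span.diff) auto
qed

lemma bump_span_support: "u \<in> bump_span \<Longrightarrow> \<bar>t\<bar> \<ge> 1 \<Longrightarrow> u t = 0"
  by (induction rule: bump_span.induct) (auto simp: flat_exp_def)

lemma bump_chain:
  fixes \<delta> :: real
  assumes "\<delta> > 0"
  obtains r where "derivative_chain r" "\<And>t. r 0 t \<ge> 0" "r 0 0 > 0" "\<And>k t. \<bar>t\<bar> \<ge> \<delta> \<Longrightarrow> r k t = 0"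
proof -
  let ?u = "\<lambda>t. flat_exp 0 (1 + t) * flat_exp 0 (1 - t)"
  obtain r where r: "derivative_chain r" "r 0 = ?u" "\<And>k. r k \<in> bump_span"
    using derivative_chain_exists[OF bump_span.base[of 0 0] bump_span_derivative] by blast
  \<comment> \<open>Rescaling from radius 1 to radius \<delta>: each derivative of the inner
    function yields one factor 1 / \<delta>.\<close>
  define r' where "r' k t = (1 / \<delta>) ^ k * r k (t / \<delta>)" for k t
  have "derivative_chain r'"
    unfolding derivative_chain_def
  proof (intro allI)
    fix k t
    have "((\<lambda>t. (1 / \<delta>) ^ k * r k (t / \<delta>)) has_real_derivative
        (1 / \<delta>) ^ k * (r (Suc k) (t / \<delta>) * (1 / \<delta>))) (at t)"
      by (intro DERIV_cmult DERIV_chain2[where f = "r k"] DERIV_cdivide DERIV_ident)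
         (use r(1) in \<open>simp add: derivative_chain_def\<close>)
    then show "(r' k has_real_derivative r' (Suc k) t) (at t)"
      by (simp add: r'_def[abs_def] mult_ac)
  qed
  moreover have "r' 0 t \<ge> 0" for t
    by (simp add: r'_def r(2) flat_exp_def)
  moreover have "r' 0 0 > 0"
    by (simp add: r'_def r(2) flat_exp_def)
  moreover have "r' k t = 0" if "\<bar>t\<bar> \<ge> \<delta>" for k t
    using that assms bump_span_support[OF r(3)[of k], of "t / \<delta>"] by (simp add: r'_def)
  ultimately show thesis using that by blast
qed

section \<open>Tensor products and their partial derivatives\<close>

definition tensor :: "('d::finite \<Rightarrow> nat \<Rightarrow> real \<Rightarrow> real) \<Rightarrow> ('d \<Rightarrow> nat) \<Rightarrow> real ^ 'd \<Rightarrow> real" where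
  "tensor r \<alpha> x = (\<Prod>i\<in>UNIV. r i (\<alpha> i) (x $ i))"

text \<open>A differentiation in direction \<open>i\<close> only raises the index of the
  \<open>i\<close>-th factor, so \<open>tensor r \<alpha>\<close> acts as the derivative of order
  \<alpha> of the product kernel.\<close>

lemma tensor_has_derivative:
  fixes r :: "'d::finite \<Rightarrow> nat \<Rightarrow> real \<Rightarrow> real"
  assumes "\<And>i. derivative_chain (r i)"
  shows "(tensor r \<alpha> has_derivative (\<lambda>h. \<Sum>i\<in>UNIV. h $ i * tensor r (\<alpha>(i := Suc (\<alpha> i))) x)) (at x)"
proof -
  have "((\<lambda>x. r i (\<alpha> i) (x $ i)) has_derivative (\<lambda>h. r i (Suc (\<alpha> i)) (x $ i) * (h $ i))) (at x)" for i
    using assms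
    by (intro has_derivative_compose[where g = "r i (\<alpha> i)" and f = "\<lambda>x. x $ i"]
        bounded_linear_imp_has_derivative bounded_linear_vec_nth)
       (simp add: derivative_chain_def has_field_derivative_def)
  then have "((\<lambda>x. \<Prod>i\<in>UNIV. r i (\<alpha> i) (x $ i)) has_derivative
      (\<lambda>h. \<Sum>i\<in>UNIV. r i (Suc (\<alpha> i)) (x $ i) * (h $ i) *
         (\<Prod>j\<in>UNIV - {i}. r j (\<alpha> j) (x $ j)))) (at x)"
    by (intro has_derivative_prod)
  moreover have "r i (Suc (\<alpha> i)) (x $ i) * (h $ i) * (\<Prod>j\<in>UNIV - {i}. r j (\<alpha> j) (x $ j))
      = h $ i * tensor r (\<alpha>(i := Suc (\<alpha> i))) x" for h i
  proof -
    have "(\<Prod>j\<in>UNIV - {i}. r j ((\<alpha>(i := Suc (\<alpha> i))) j) (x $ j)) = (\<Prod>j\<in>UNIV - {i}. r j (\<alpha> j) (x $ j))"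
      by (rule prod.cong) auto
    then show ?thesis
      by (simp add: tensor_def prod.remove[of UNIV i])
  qed
  ultimately show ?thesis
    by (simp add: tensor_def[abs_def])
qed

lemma continuous_on_tensor:
  "(\<And>i. derivative_chain (r i)) \<Longrightarrow> continuous_on S (tensor r \<alpha>)"
  by (meson continuous_at_imp_continuous_on has_derivative_continuous tensor_has_derivative)

lemma partials_tensor:
  fixes r :: "'d::finite \<Rightarrow> nat \<Rightarrow> real \<Rightarrow> real"
  assumes "\<And>i. derivative_chain (r i)"
  shows "partials is (tensor r (\<lambda>_. 0)) = tensor r (count_list is)"
proof (induction "is")
  case Nil
  then show ?case by (simp add: partials_def count_list.simps[abs_def])
next
  case (Cons j "is")
  have "partial j (tensor r \<alpha>) = tensor r (\<alpha>(j := Suc (\<alpha> j)))" for \<alpha>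
  proof
    fix x
    have "(\<Sum>i\<in>UNIV. axis j 1 $ i * tensor r (\<alpha>(i := Suc (\<alpha> i))) x)
        = (\<Sum>i\<in>UNIV. if i = j then tensor r (\<alpha>(i := Suc (\<alpha> i))) x else 0)"
      by (intro sum.cong) (auto simp: axis_def)
    then show "partial j (tensor r \<alpha>) x = tensor r (\<alpha>(j := Suc (\<alpha> j))) x"
      by (simp add: partial_def frechet_derivative_at[OF tensor_has_derivative[OF assms], symmetric])
  qed
  moreover have "(count_list is)(j := Suc (count_list is j)) = count_list (j # is)"
    by (auto simp: fun_eq_iff)
  moreover have "partials (j # is) (tensor r (\<lambda>_. 0)) = partial j (partials is (tensor r (\<lambda>_. 0)))"
    by (simp add: partials_def)
  ultimately show ?case
    by (simp only: Cons)
qed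

lemma smooth_tensor:
  "(\<And>i. derivative_chain (r i)) \<Longrightarrow> smooth (tensor r (\<lambda>_. 0))"
  unfolding smooth_def differentiable_on_def differentiable_def
  by (simp add: partials_tensor) (blast intro: tensor_has_derivative)

text \<open>\<open>classical_D\<close> fixes an order of differentiation by \<open>SOME\<close>. A
  list with the prescribed counts exists, as an enumeration of the multiset with multiplicities
  \<alpha>, and for tensors the result depends on the counts alone.\<close>

lemma classical_D_tensor:
  fixes \<alpha> :: "'d::finite \<Rightarrow> nat"
  assumes "\<And>i. derivative_chain (r i)"
  shows "classical_D \<alpha> (tensor r (\<lambda>_. 0)) = tensor r \<alpha>"
proof -
  define A where "A = Abs_multiset \<alpha>"
  have "\<exists>is. \<forall>i. count_list is i = \<alpha> i"
  proof -
    obtain "is" where "mset is = A" by (metis ex_mset)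
    moreover have "count A i = \<alpha> i" for i
      by (simp add: A_def count_Abs_multiset)
    ultimately show ?thesis by (metis count_mset)
  qed
  then have "count_list (SOME is. \<forall>i. count_list is i = \<alpha> i) = \<alpha>"
    by (intro ext) (rule someI2_ex[where P = "\<lambda>is. \<forall>i. count_list is i = \<alpha> i"], auto)
  then show ?thesis
    by (simp add: classical_D_def partials_tensor[OF assms])
qed

text \<open>As a function of \<open>y\<close>, the kernel centred at \<open>z\<close> has its
  support in the closed box of radius \<delta> around \<open>z\<close>, which the margin conditions
  keep inside the open cube. Each derivative of \<open>z - y\<close> changes the sign; this will
  cancel the sign in \<open>has_weak_D\<close>.\<close>

lemma bump_kernel_test_function:
  fixes z :: "real ^ 'd::finite"
  assumes r: "derivative_chain r" "\<And>k t. \<bar>t\<bar> \<ge> \<delta> \<Longrightarrow> r k t = 0" and "\<delta> > 0"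
    and z: "\<And>i. \<delta> < z $ i" "\<And>i. z $ i < 1 - \<delta>"
  shows "test_function (\<lambda>y. tensor (\<lambda>_. r) (\<lambda>_. 0) (z - y))" (is "test_function ?\<phi>")
    and "classical_D \<alpha> (\<lambda>y. tensor (\<lambda>_. r) (\<lambda>_. 0) (z - y))
      = (\<lambda>y. (-1) ^ mi_order \<alpha> * tensor (\<lambda>_. r) \<alpha> (z - y))"
proof -
  define s where "s i k t = (-1) ^ k * r k (z $ i - t)" for i k t
  have s: "derivative_chain (s i)" for i
    unfolding derivative_chain_def
  proof (intro allI)
    fix k t
    have "((\<lambda>t. (-1) ^ k * r k (z $ i - t)) has_real_derivative
        (-1) ^ k * (r (Suc k) (z $ i - t) * (0 - 1))) (at t)"
      by (intro DERIV_cmult DERIV_chain2[where f = "r k"] derivative_intros)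
         (use r(1) in \<open>simp add: derivative_chain_def\<close>)
    then show "(s i k has_real_derivative s i (Suc k) t) (at t)"
      by (simp add: s_def[abs_def])
  qed
  have eq: "tensor s \<alpha> y = (-1) ^ mi_order \<alpha> * tensor (\<lambda>_. r) \<alpha> (z - y)" for \<alpha> y
    by (simp add: tensor_def s_def prod.distrib mi_order_def power_sum)
  have \<phi>: "?\<phi> = tensor s (\<lambda>_. 0)"
    by (simp add: eq fun_eq_iff mi_order_def)
  show "classical_D \<alpha> ?\<phi> = (\<lambda>y. (-1) ^ mi_order \<alpha> * tensor (\<lambda>_. r) \<alpha> (z - y))"
    by (simp add: \<phi> classical_D_tensor[OF s] eq fun_eq_iff)
  have "{y. ?\<phi> y \<noteq> 0} \<subseteq> cbox (z - (\<chi> i. \<delta>)) (z + (\<chi> i. \<delta>))"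
  proof
    fix y assume "y \<in> {y. ?\<phi> y \<noteq> 0}"
    then have "r 0 (z $ i - y $ i) \<noteq> 0" for i
      by (simp add: tensor_def)
    then have "\<bar>z $ i - y $ i\<bar> < \<delta>" for i
      by (meson not_le r(2))
    then show "y \<in> cbox (z - (\<chi> i. \<delta>)) (z + (\<chi> i. \<delta>))"
      by (simp add: mem_box_cart) (smt (verit))
  qed
  then have sub: "closure {y. ?\<phi> y \<noteq> 0} \<subseteq> cbox (z - (\<chi> i. \<delta>)) (z + (\<chi> i. \<delta>))"
    by (intro closure_minimal closed_cbox)
  moreover have "cbox (z - (\<chi> i. \<delta>)) (z + (\<chi> i. \<delta>)) \<subseteq> box 0 1"
  proof
    fix y assume y: "y \<in> cbox (z - (\<chi> i. \<delta>)) (z + (\<chi> i. \<delta>))"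
    have "0 < y $ i \<and> y $ i < 1" for i
      using y[unfolded mem_box_cart, rule_format, of i] z(1)[of i] z(2)[of i] by simp
    then show "y \<in> box 0 1"
      by (simp add: mem_box_cart)
  qed
  moreover have "compact (closure {y. ?\<phi> y \<noteq> 0})"
    unfolding compact_eq_bounded_closed by (intro conjI bounded_subset[OF bounded_cbox sub] closed_closure)
  moreover have "smooth ?\<phi>"
    unfolding \<phi> by (rule smooth_tensor[OF s])
  ultimately show "test_function ?\<phi>"
    unfolding test_function_def by blast
qed

section \<open>Mollification and local polynomial approximation\<close>

text \<open>The derivative of order \<alpha> of the convolution of \<open>f\<close> with the kernel,
  all derivatives falling on the kernel. The kernel is not normalised: its mass is
  \<open>mollified r (\<lambda>_. 1) (\<lambda>_. 0)\<close> and is divided out at the end.\<close>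

definition mollified ::
  "(nat \<Rightarrow> real \<Rightarrow> real) \<Rightarrow> (real ^ 'd::finite \<Rightarrow> real) \<Rightarrow> ('d \<Rightarrow> nat) \<Rightarrow> real ^ 'd \<Rightarrow> real" where
  "mollified r f \<alpha> p = integral (cbox 0 1) (\<lambda>y. f y * tensor (\<lambda>_. r) \<alpha> (p - y))"

text \<open>Differentiation under the integral sign. Derivatives along lines are enough, since
  Taylor's formula is applied on segments.\<close>

lemma mollified_line_derivative:
  fixes f :: "real ^ 'd::finite \<Rightarrow> real"
  assumes f: "continuous_on (cbox 0 1) f" and r: "derivative_chain r"
  shows "((\<lambda>t. mollified r f \<alpha> (p + t *\<^sub>R v)) has_real_derivative
     (\<Sum>i\<in>UNIV. v $ i * mollified r f (\<alpha>(i := Suc (\<alpha> i))) (p + t *\<^sub>R v))) (at t)"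
proof -
  let ?\<Phi> = "tensor (\<lambda>_::'d. r)"
  let ?fx = "\<lambda>t y. f y * (\<Sum>i\<in>UNIV. v $ i * ?\<Phi> (\<alpha>(i := Suc (\<alpha> i))) (p + t *\<^sub>R v - y))"
  have cont: "continuous_on S (\<lambda>y. ?\<Phi> \<beta> (g y))" if "continuous_on S g"
    for S :: "'b::topological_space set" and g \<beta>
    by (rule continuous_on_compose2[OF continuous_on_tensor[of _ UNIV] that]) (use r in auto)
  have int: "(\<lambda>y. f y * ?\<Phi> \<beta> (p + t *\<^sub>R v - y)) integrable_on cbox 0 1" for \<beta> t
    by (intro integrable_continuous continuous_intros cont f)
  have "((\<lambda>t. mollified r f \<alpha> (p + t *\<^sub>R v)) has_real_derivative
      integral (cbox 0 1) (?fx t)) (at t)"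
    unfolding mollified_def
  proof (rule leibniz_rule_field_derivative[where U = UNIV])
    fix t :: real and y :: "real ^ 'd"
    have "((\<lambda>t. ?\<Phi> \<alpha> (p + t *\<^sub>R v - y)) has_derivative
        (\<lambda>h. \<Sum>i\<in>UNIV. (h *\<^sub>R v) $ i * ?\<Phi> (\<alpha>(i := Suc (\<alpha> i))) (p + t *\<^sub>R v - y))) (at t)"
      by (rule has_derivative_compose[OF _ tensor_has_derivative])
         (use r in \<open>auto intro!: derivative_eq_intros\<close>)
    then have "((\<lambda>t. ?\<Phi> \<alpha> (p + t *\<^sub>R v - y)) has_real_derivative
        (\<Sum>i\<in>UNIV. v $ i * ?\<Phi> (\<alpha>(i := Suc (\<alpha> i))) (p + t *\<^sub>R v - y))) (at t)"
      unfolding has_field_derivative_def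
      by (rule has_derivative_eq_rhs) (simp add: fun_eq_iff sum_distrib_left sum_distrib_right mult_ac)
    then show "((\<lambda>t. f y * ?\<Phi> \<alpha> (p + t *\<^sub>R v - y)) has_real_derivative ?fx t y) (at t)"
      by (rule DERIV_cmult)
  next
    have "continuous_on (UNIV \<times> cbox 0 1) (\<lambda>u. f (snd u))"
      by (intro continuous_on_compose2[OF f] continuous_intros) auto
    then show "continuous_on (UNIV \<times> cbox 0 1) (\<lambda>(t, y). ?fx t y)"
      unfolding case_prod_beta by (intro continuous_intros cont)
  qed (use int in auto)
  moreover have "integral (cbox 0 1) (?fx t) =
      (\<Sum>i\<in>UNIV. v $ i * mollified r f (\<alpha>(i := Suc (\<alpha> i))) (p + t *\<^sub>R v))"
  proof -
    have "?fx t = (\<lambda>y. \<Sum>i\<in>UNIV. v $ i * (f y * ?\<Phi> (\<alpha>(i := Suc (\<alpha> i))) (p + t *\<^sub>R v - y)))"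
      by (simp add: sum_distrib_left mult_ac)
    then show ?thesis
      using int by (simp add: integral_sum integrable_on_mult_right mollified_def)
  qed
  ultimately show ?thesis by simp
qed

text \<open>The factor of a Taylor term that belongs to the ordered list of directions
  \<open>is\<close>. Summing over lists instead of multi-indices replaces multinomial coefficients
  by repetitions, so that all terms of degree k carry the same 1 / k!.\<close>

definition direction_monomial :: "real ^ 'd \<Rightarrow> 'd list \<Rightarrow> real" where
  "direction_monomial v is = prod_list (map (($) v) is)"

lemma finite_lists_of_length [simp]: "finite {is :: 'd::finite list. length is = k}"
  using finite_lists_length_eq[of "UNIV :: 'd set" k] by simp

lemma sum_lists_Suc:
  fixes g :: "'d::finite list \<Rightarrow> 'b::comm_monoid_add"
  shows "(\<Sum>is | length is = Suc k. g is) = (\<Sum>is | length is = k. \<Sum>i\<in>UNIV. g (i # is))"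
proof -
  have "(\<Sum>is | length is = k. \<Sum>i\<in>UNIV. g (i # is)) =
      (\<Sum>(is, i)\<in>{is. length is = k} \<times> UNIV. g (i # is))"
    by (simp add: sum.cartesian_product)
  also have "\<dots> = (\<Sum>is | length is = Suc k. g is)"
    by (rule sum.reindex_bij_witness[of _ "\<lambda>is. (tl is, hd is)" "\<lambda>(is, i). i # is"])
       (auto simp: length_Suc_conv)
  finally show ?thesis by simp
qed

text \<open>The multinomial expansion in terms of ordered lists. It is the reason why distances are
  measured in the l1 norm from here on.\<close>

lemma sum_direction_monomial:
  fixes v :: "real ^ 'd::finite"
  shows "(\<Sum>is | length is = k. \<bar>direction_monomial v is\<bar>) = (\<Sum>i\<in>UNIV. \<bar>v $ i\<bar>) ^ k"
proof (induction k)
  case (Suc k)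
  show ?case
    unfolding sum_lists_Suc power_Suc Suc.IH[symmetric]
    by (simp add: direction_monomial_def abs_mult sum_product sum_distrib_right sum_distrib_left
        sum.swap[of _ UNIV] mult_ac)
qed (simp add: direction_monomial_def)

lemma count_list_Cons_upd: "count_list (i # is) = (count_list is)(i := Suc (count_list is i))"
  by (auto simp: fun_eq_iff)

text \<open>The one-dimensional expansion with Lagrange remainder, applied to the restriction to the
  points \<open>p + t *\<^sub>R v\<close>; \<open>h k\<close> is the k-th derivative of this
  restriction.\<close>

lemma mollified_taylor:
  fixes f :: "real ^ 'd::finite \<Rightarrow> real"
  assumes f: "continuous_on (cbox 0 1) f" and r: "derivative_chain r"
    and B: "\<And>is t. length is = n \<Longrightarrow> 0 \<le> t \<Longrightarrow> t \<le> 1 \<Longrightarrow>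
              \<bar>mollified r f (count_list is) (p + t *\<^sub>R v)\<bar> \<le> B"
  shows "\<bar>mollified r f (\<lambda>_. 0) (p + v) - (\<Sum>k<n. \<Sum>is | length is = k.
           mollified r f (count_list is) p / fact k * direction_monomial v is)\<bar>
         \<le> B * (\<Sum>i\<in>UNIV. \<bar>v $ i\<bar>) ^ n / fact n"
proof -
  define h where "h k t = (\<Sum>is | length is = k.
      direction_monomial v is * mollified r f (count_list is) (p + t *\<^sub>R v))" for k and t :: real
  have "(h k has_real_derivative h (Suc k) t) (at t)" for k t
  proof -
    have "(h k has_real_derivative (\<Sum>is | length is = k. direction_monomial v is *
        (\<Sum>i\<in>UNIV. v $ i * mollified r f (count_list (i # is)) (p + t *\<^sub>R v)))) (at t)"
      unfolding h_def[abs_def] count_list_Cons_upd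
      by (intro DERIV_sum DERIV_cmult mollified_line_derivative f r)
    also have "(\<Sum>is | length is = k. direction_monomial v is *
        (\<Sum>i\<in>UNIV. v $ i * mollified r f (count_list (i # is)) (p + t *\<^sub>R v))) = h (Suc k) t"
      unfolding h_def sum_lists_Suc
      by (simp add: direction_monomial_def sum_distrib_left mult_ac del: count_list.simps)
    finally show ?thesis .
  qed
  then obtain t where t: "0 < t" "t \<le> 1"
    and eq: "h 0 1 = (\<Sum>k<n. h k 0 / fact k * 1 ^ k) + h n t / fact n * 1 ^ n"
    using Maclaurin2[of 1 h "h 0" n] by auto
  have "\<bar>h n t\<bar> \<le> (\<Sum>is | length is = n. \<bar>direction_monomial v is\<bar> * B)"
    unfolding h_def
    by (rule order_trans[OF sum_abs]) (use B t in \<open>auto simp: abs_mult intro!: sum_mono mult_left_mono\<close>)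
  also have "\<dots> = B * (\<Sum>i\<in>UNIV. \<bar>v $ i\<bar>) ^ n"
    unfolding sum_distrib_right[symmetric] sum_direction_monomial by (rule mult.commute)
  finally have "\<bar>h n t / fact n\<bar> \<le> B * (\<Sum>i\<in>UNIV. \<bar>v $ i\<bar>) ^ n / fact n"
    by (simp add: divide_right_mono)
  moreover have "h 0 1 = mollified r f (\<lambda>_. 0) (p + v)"
    by (simp add: h_def direction_monomial_def count_list.simps[abs_def])
  moreover have "(\<Sum>k<n. h k 0 / fact k * 1 ^ k) = (\<Sum>k<n. \<Sum>is | length is = k.
           mollified r f (count_list is) p / fact k * direction_monomial v is)"
    by (simp add: h_def sum_divide_distrib mult_ac)
  ultimately show ?thesis
    using eq by (simp only: power_one mult_1_right)
qed

section \<open>From bounds on weak derivatives to bounds on the mollification\<close>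

lemma finite_mi_order_le: "finite {\<alpha> :: 'd::finite \<Rightarrow> nat. mi_order \<alpha> \<le> n}"
proof (rule finite_subset)
  show "{\<alpha> :: 'd \<Rightarrow> nat. mi_order \<alpha> \<le> n} \<subseteq> (\<Pi>\<^sub>E i\<in>UNIV. {..n})"
  proof
    fix \<alpha> :: "'d \<Rightarrow> nat" assume "\<alpha> \<in> {\<alpha>. mi_order \<alpha> \<le> n}"
    then have "\<alpha> i \<le> n" for i
      using member_le_sum[of i UNIV \<alpha>] by (simp add: mi_order_def)
    then show "\<alpha> \<in> (\<Pi>\<^sub>E i\<in>UNIV. {..n})" by auto
  qed
qed (simp add: finite_PiE)

text \<open>A norm of at most 1 excludes the value \<infinity>, so \<open>SOME\<close> picks a
  genuine weak derivative, and its essential supremum is below the maximum.\<close>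

lemma sobolev_norm_le_1D:
  fixes f :: "real ^ 'd::finite \<Rightarrow> real"
  assumes "sobolev_norm n f \<le> 1" and "mi_order \<alpha> \<le> n"
  obtains g where "has_weak_D \<alpha> f g" "AE x in lebesgue. x \<in> cbox 0 1 \<longrightarrow> \<bar>g x\<bar> \<le> 1"
proof -
  let ?M = "restrict_space lebesgue (cbox 0 (1 :: real ^ 'd))"
  let ?E = "\<lambda>\<alpha>. esssup ?M (\<lambda>x. ereal \<bar>weak_D \<alpha> f x\<bar>)"
  have ex: "\<forall>\<alpha>. mi_order \<alpha> \<le> n \<longrightarrow> (\<exists>g. has_weak_D \<alpha> f g)"
    using assms(1) unfolding sobolev_norm_def by (auto split: if_splits)
  then have "Max (?E ` {\<alpha>. mi_order \<alpha> \<le> n}) \<le> 1"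
    using assms(1) unfolding sobolev_norm_def by simp
  moreover have "?E \<alpha> \<le> Max (?E ` {\<alpha>. mi_order \<alpha> \<le> n})"
    using finite_mi_order_le assms(2) by (intro Max_ge) auto
  ultimately have "?E \<alpha> \<le> 1" by (rule order_trans[rotated])
  then have "AE x in ?M. \<bar>weak_D \<alpha> f x\<bar> \<le> 1"
    using esssup_AE[of "\<lambda>x. ereal \<bar>weak_D \<alpha> f x\<bar>" ?M]
    by (auto elim!: eventually_mono dest: order_trans)
  then have "AE x in lebesgue. x \<in> cbox 0 1 \<longrightarrow> \<bar>weak_D \<alpha> f x\<bar> \<le> 1"
    by (subst (asm) AE_restrict_space_iff) auto
  moreover have "has_weak_D \<alpha> f (weak_D \<alpha> f)"
    unfolding weak_D_def using ex assms(2) by (metis someI_ex)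
  ultimately show thesis using that by blast
qed

text \<open>Links the open box, over which weak derivatives are tested, to the closed cube in
  \<open>mollified\<close>; the faces have measure zero.\<close>

lemma set_integral_box_eq:
  fixes g :: "real ^ 'd::finite \<Rightarrow> real"
  assumes "continuous_on (cbox 0 1) g"
  shows "set_integrable lebesgue (box 0 1) g"
    and "(LINT x:box 0 1|lebesgue. g x) = integral (cbox 0 1) g"
proof -
  have "g absolutely_integrable_on cbox 0 1"
    using assms by (rule absolutely_integrable_continuous)
  then show *: "set_integrable lebesgue (box 0 1) g"
    by (rule set_integrable_subset) (auto simp: box_subset_cbox)
  show "(LINT x:box 0 1|lebesgue. g x) = integral (cbox 0 1) g"
    by (simp add: set_lebesgue_integral_eq_integral(2)[OF *] integral_open_interval)
qed

text \<open>With the kernel around \<open>z\<close> as test function, the definition of the weak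
  derivative moves the derivatives from the kernel to \<open>f\<close>. What remains is the integral
  of a function bounded by 1 almost everywhere against a nonnegative kernel, hence at most the mass
  of the kernel.\<close>

lemma mollified_bound:
  fixes f :: "real ^ 'd::finite \<Rightarrow> real"
  assumes f: "continuous_on (cbox 0 1) f" "sobolev_norm n f \<le> 1" "mi_order \<alpha> \<le> n"
    and r: "derivative_chain r" "\<And>k t. \<bar>t\<bar> \<ge> \<delta> \<Longrightarrow> r k t = 0" "\<And>t. r 0 t \<ge> 0" and "\<delta> > 0"
    and z: "\<And>i. \<delta> < z $ i" "\<And>i. z $ i < 1 - \<delta>"
  shows "\<bar>mollified r f \<alpha> z\<bar> \<le> mollified r (\<lambda>_. 1) (\<lambda>_. 0) z"
proof -
  let ?\<Phi> = "tensor (\<lambda>_::'d. r)"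
  let ?\<phi> = "\<lambda>y. ?\<Phi> (\<lambda>_. 0) (z - y)"
  obtain g where g: "has_weak_D \<alpha> f g" "AE x in lebesgue. x \<in> cbox 0 1 \<longrightarrow> \<bar>g x\<bar> \<le> 1"
    using sobolev_norm_le_1D[OF f(2,3)] by blast
  have cont: "continuous_on S (\<lambda>y. ?\<Phi> \<beta> (z - y))" for S \<beta>
    by (rule continuous_on_compose2[OF continuous_on_tensor[of _ UNIV]])
       (use r in \<open>auto intro!: continuous_intros\<close>)
  have test: "test_function ?\<phi>"
    and D: "classical_D \<alpha> ?\<phi> = (\<lambda>y. (-1) ^ mi_order \<alpha> * ?\<Phi> \<alpha> (z - y))"
    using bump_kernel_test_function[OF r(1,2) \<open>\<delta> > 0\<close> z] by blast+
  have "mollified r f \<alpha> z = (LINT y:box 0 1|lebesgue. f y * ?\<Phi> \<alpha> (z - y))"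
    unfolding mollified_def by (intro set_integral_box_eq(2)[symmetric] continuous_intros f cont)
  \<comment> \<open>The sign from differentiating in \<open>z - y\<close> appears here and cancels
    in the next step against the sign in \<open>has_weak_D\<close>.\<close>
  also have "\<dots> = (-1) ^ mi_order \<alpha> * (LINT y:box 0 1|lebesgue. f y * classical_D \<alpha> ?\<phi> y)"
    unfolding D by (cases "even (mi_order \<alpha>)") (simp_all add: set_lebesgue_integral_def)
  also have "\<dots> = (LINT y:box 0 1|lebesgue. g y * ?\<phi> y)"
    using g(1) test by (simp add: has_weak_D_def flip: power_mult_distrib mult.assoc)
  finally have "\<bar>mollified r f \<alpha> z\<bar> \<le> (LINT y:box 0 1|lebesgue. \<bar>g y * ?\<phi> y\<bar>)"
    unfolding set_lebesgue_integral_def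
    by (simp add: order_trans[OF integral_abs_bound] abs_mult)
  also have "\<dots> \<le> (LINT y:box 0 1|lebesgue. ?\<phi> y)"
    unfolding set_lebesgue_integral_def
  proof (rule integral_mono_AE')
    show "integrable lebesgue (\<lambda>y. indicator (box 0 1) y *\<^sub>R ?\<phi> y)"
      using set_integral_box_eq(1)[OF cont] by (simp add: set_integrable_def)
    have nonneg: "?\<phi> y \<ge> 0" for y
      using r(3) by (simp add: tensor_def prod_nonneg)
    then show "AE y in lebesgue. 0 \<le> indicator (box 0 1) y *\<^sub>R ?\<phi> y"
      by (simp add: indicator_def)
    show "AE y in lebesgue. indicator (box 0 1) y *\<^sub>R \<bar>g y * ?\<phi> y\<bar> \<le> indicator (box 0 1) y *\<^sub>R ?\<phi> y"
      using g(2)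
    proof eventually_elim
      case (elim y)
      show ?case
      proof (cases "y \<in> box 0 1")
        case True
        then have "\<bar>g y\<bar> \<le> 1" using elim box_subset_cbox by blast
        then show ?thesis
          using nonneg[of y] mult_right_mono[of "\<bar>g y\<bar>" 1 "?\<phi> y"]
          by (simp add: abs_mult indicator_def)
      qed simp
    qed
  qed
  also have "\<dots> = mollified r (\<lambda>_. 1) (\<lambda>_. 0) z"
    unfolding mollified_def by (simp add: set_integral_box_eq(2)[OF cont])
  finally show ?thesis .
qed

text \<open>For \<open>z\<close> at distance more than \<open>\<delta>\<close> from the boundary the cube contains the whole support of
  the kernel, so its mass does not depend on \<open>z\<close>.\<close>

lemma mollified_1:
  fixes r :: "nat \<Rightarrow> real \<Rightarrow> real"
  assumes r: "derivative_chain r" "\<And>k t. \<bar>t\<bar> \<ge> \<delta> \<Longrightarrow> r k t = 0" "\<And>t. r 0 t \<ge> 0" "r 0 0 > 0"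
    and "\<delta> > 0"
  obtains I where "I > 0"
    "\<And>z :: real ^ 'd::finite. (\<And>i. \<delta> < z $ i) \<Longrightarrow> (\<And>i. z $ i < 1 - \<delta>) \<Longrightarrow>
       mollified r (\<lambda>_. 1) (\<lambda>_. 0) z = I"
proof -
  let ?\<Phi> = "tensor (\<lambda>_::'d. r) (\<lambda>_. 0)"
  let ?\<delta> = "(\<chi> i. \<delta>) :: real ^ 'd"
  define I where "I = integral (cbox (-?\<delta>) ?\<delta>) ?\<Phi>"
  have int: "?\<Phi> integrable_on cbox (-?\<delta>) ?\<delta>"
    by (intro integrable_continuous continuous_on_tensor) (use r in auto)
  have pos: "?\<Phi> y \<ge> 0" for y
    using r(3) by (simp add: tensor_def prod_nonneg)
  have "I \<ge> 0"
    unfolding I_def using pos by (intro integral_nonneg int) auto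
  moreover have "I \<noteq> 0"
  proof
    assume "I = 0"
    have "?\<Phi> 0 = 0"
    proof (rule has_integral_0_cbox_imp_0[where f = ?\<Phi> and x = 0])
      show "continuous_on (cbox (-?\<delta>) ?\<delta>) ?\<Phi>"
        by (intro continuous_on_tensor) (use r in auto)
      show "(?\<Phi> has_integral 0) (cbox (-?\<delta>) ?\<delta>)"
        using int \<open>I = 0\<close> unfolding I_def by (metis integrable_integral)
    qed (use pos \<open>\<delta> > 0\<close> in \<open>auto simp: mem_box_cart interval_ne_empty_cart\<close>)
    moreover have "?\<Phi> 0 > 0"
      using r(4) by (simp add: tensor_def prod_pos)
    ultimately show False by simp
  qed
  ultimately have "I > 0" by simp
  moreover have "mollified r (\<lambda>_. 1) (\<lambda>_. 0) z = I"
    if z: "\<And>i. \<delta> < z $ i" "\<And>i. z $ i < 1 - \<delta>" for z :: "real ^ 'd"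
  proof -
    have "(?\<Phi> has_integral I) (cbox (-?\<delta>) ?\<delta>)"
      using int unfolding I_def by (rule integrable_integral)
    from has_integral_affinity[OF this, of "-1" z]
    have "((\<lambda>y. ?\<Phi> (z - y)) has_integral I) ((\<lambda>y. z - y) ` cbox (-?\<delta>) ?\<delta>)"
      by simp
    then have "((\<lambda>y. ?\<Phi> (z - y)) has_integral I) (cbox 0 1)"
    proof (rule has_integral_on_superset)
      show "(\<lambda>y. z - y) ` cbox (-?\<delta>) ?\<delta> \<subseteq> cbox 0 1"
      proof
        fix y assume "y \<in> (\<lambda>y. z - y) ` cbox (-?\<delta>) ?\<delta>"
        then obtain w where w: "y = z - w" "w \<in> cbox (-?\<delta>) ?\<delta>" by blast
        have "0 \<le> y $ i \<and> y $ i \<le> 1" for i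
          using w(2)[unfolded mem_box_cart, rule_format, of i] z(1)[of i] z(2)[of i] by (simp add: w(1))
        then show "y \<in> cbox 0 1" by (simp add: mem_box_cart)
      qed
      fix y assume "y \<notin> (\<lambda>y. z - y) ` cbox (-?\<delta>) ?\<delta>"
      then have "z - y \<notin> cbox (-?\<delta>) ?\<delta>"
        by (metis diff_diff_eq2 add_diff_cancel_left' imageI)
      then obtain i where "\<not> (- \<delta> \<le> (z - y) $ i \<and> (z - y) $ i \<le> \<delta>)"
        by (auto simp: mem_box_cart)
      then have "r 0 ((z - y) $ i) = 0" by (intro r(2)) linarith
      then show "?\<Phi> (z - y) = 0"
        unfolding tensor_def by (intro prod_zero) auto
    qed
    then show ?thesis
      by (simp add: mollified_def integral_unique)
  qed
  ultimately show thesis using that by blast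
qed

text \<open>The integrand lives where the kernel does, that is near \<open>p\<close>. The constant
  \<open>c\<close> need not be \<open>f p\<close>: it will be \<open>f x\<close>, with
  \<open>p\<close> the contracted image of \<open>x\<close>.\<close>

lemma mollified_close:
  fixes f :: "real ^ 'd::finite \<Rightarrow> real"
  assumes f: "continuous_on (cbox 0 1) f"
    and r: "derivative_chain r" "\<And>k t. \<bar>t\<bar> \<ge> \<delta> \<Longrightarrow> r k t = 0" "\<And>t. r 0 t \<ge> 0"
    and close: "\<And>y. y \<in> cbox 0 1 \<Longrightarrow> (\<And>i. \<bar>y $ i - p $ i\<bar> < \<delta>) \<Longrightarrow> \<bar>f y - c\<bar> \<le> \<eta>"
  shows "\<bar>mollified r f (\<lambda>_. 0) p - c * mollified r (\<lambda>_. 1) (\<lambda>_. 0) p\<bar>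
    \<le> \<eta> * mollified r (\<lambda>_. 1) (\<lambda>_. 0) p"
proof -
  let ?\<Phi> = "\<lambda>y. tensor (\<lambda>_::'d. r) (\<lambda>_. 0) (p - y)"
  have cont: "continuous_on S ?\<Phi>" for S
    by (rule continuous_on_compose2[OF continuous_on_tensor[of _ UNIV]])
       (use r in \<open>auto intro!: continuous_intros\<close>)
  have int: "?\<Phi> integrable_on cbox 0 1" "(\<lambda>y. f y * ?\<Phi> y) integrable_on cbox 0 1"
    by (intro integrable_continuous continuous_intros cont f)+
  have "mollified r f (\<lambda>_. 0) p - c * mollified r (\<lambda>_. 1) (\<lambda>_. 0) p
      = integral (cbox 0 1) (\<lambda>y. f y * ?\<Phi> y - c * ?\<Phi> y)"
    using int by (simp add: mollified_def integral_diff integrable_on_mult_right)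
  also have "\<dots> = integral (cbox 0 1) (\<lambda>y. (f y - c) * ?\<Phi> y)"
    by (simp add: algebra_simps)
  also have "norm \<dots> \<le> integral (cbox 0 1) (\<lambda>y. \<eta> * ?\<Phi> y)"
  proof (rule integral_norm_bound_integral)
    show "(\<lambda>y. (f y - c) * ?\<Phi> y) integrable_on cbox 0 1"
      by (intro integrable_continuous continuous_intros cont f)
    show "(\<lambda>y. \<eta> * ?\<Phi> y) integrable_on cbox 0 1"
      using int by (simp add: integrable_on_mult_right)
    fix y :: "real ^ 'd" assume y: "y \<in> cbox 0 1"
    show "norm ((f y - c) * ?\<Phi> y) \<le> \<eta> * ?\<Phi> y"
    proof (cases "?\<Phi> y = 0")
      case False
      then have "r 0 (p $ i - y $ i) \<noteq> 0" for i
        by (simp add: tensor_def)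
      then have "\<bar>y $ i - p $ i\<bar> < \<delta>" for i
        by (metis abs_minus_commute not_le r(2))
      then have "\<bar>f y - c\<bar> \<le> \<eta>" using close y by blast
      moreover have "?\<Phi> y \<ge> 0"
        using r(3) by (simp add: tensor_def prod_nonneg)
      ultimately show ?thesis by (simp add: abs_mult mult_right_mono)
    qed simp
  qed
  finally show ?thesis
    by (simp add: mollified_def)
qed

lemma direction_monomial_scaleR:
  "direction_monomial (a *\<^sub>R v) is = a ^ length is * direction_monomial v is"
  by (induction "is") (simp_all add: direction_monomial_def)

text \<open>The cube is first contracted towards its centre: this makes room for the mollifying kernel,
  so that the estimate holds up to the boundary, where the weak derivatives give no direct
  information.\<close>

lemma local_polynomial_approximation:
  fixes f :: "real ^ 'd::finite \<Rightarrow> real"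
  assumes f: "continuous_on (cbox 0 1) f" "sobolev_norm n f \<le> 1" and "\<eta> > 0"
  obtains c where "\<And>x z. x \<in> cbox 0 1 \<Longrightarrow> z \<in> cbox 0 1 \<Longrightarrow>
    \<bar>f x - (\<Sum>k<n. \<Sum>is | length is = k. c is z * direction_monomial (x - z) is)\<bar>
      \<le> \<eta> + (\<Sum>i\<in>UNIV. \<bar>x $ i - z $ i\<bar>) ^ n"
proof -
  let ?d = "real CARD('d)"
  have "uniformly_continuous_on (cbox 0 1) f"
    by (simp add: compact_uniformly_continuous f(1))
  then obtain \<delta>\<^sub>0 where \<delta>\<^sub>0: "\<delta>\<^sub>0 > 0"
    "\<And>x y. x \<in> cbox 0 1 \<Longrightarrow> y \<in> cbox 0 1 \<Longrightarrow> dist y x < \<delta>\<^sub>0 \<Longrightarrow> dist (f y) (f x) < \<eta>"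
    using \<open>\<eta> > 0\<close> unfolding uniformly_continuous_on_def by metis
  \<comment> \<open>Contraction moves a coordinate by at most 2 \<delta> and the kernel reaches
    \<delta> further, so the l1 distance is at most 3 \<delta> times the dimension; the 4 makes the
    comparison with \<open>\<delta>\<^sub>0\<close> strict. The bound 1 / 8 keeps the factor
    \<open>a\<close> at least 1 / 2.\<close>
  define \<delta> where "\<delta> = min (1 / 8) (\<delta>\<^sub>0 / (4 * ?d))"
  have \<delta>: "\<delta> > 0" "\<delta> \<le> 1 / 8" "?d * (3 * \<delta>) < \<delta>\<^sub>0"
  proof -
    have "?d * (4 * \<delta>) \<le> ?d * (4 * (\<delta>\<^sub>0 / (4 * ?d)))"
      by (intro mult_left_mono) (auto simp: \<delta>_def)
    then have "?d * (4 * \<delta>) \<le> \<delta>\<^sub>0" by simp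
    then show "?d * (3 * \<delta>) < \<delta>\<^sub>0" using \<delta>\<^sub>0(1) by linarith
  qed (use \<delta>\<^sub>0(1) in \<open>auto simp: \<delta>_def\<close>)
  obtain r where r: "derivative_chain r" "\<And>t. r 0 t \<ge> 0" "r 0 0 > 0" "\<And>k t. \<bar>t\<bar> \<ge> \<delta> \<Longrightarrow> r k t = 0"
    using bump_chain[OF \<delta>(1)] by blast
  obtain I where I: "I > 0" "\<And>z :: real ^ 'd. (\<And>i. \<delta> < z $ i) \<Longrightarrow> (\<And>i. z $ i < 1 - \<delta>) \<Longrightarrow>
       mollified r (\<lambda>_. 1) (\<lambda>_. 0) z = I"
    using mollified_1[OF r(1,4,2,3) \<delta>(1)] by blast
  \<comment> \<open>\<open>T\<close> fixes the centre and maps [0, 1] in each coordinate onto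
    [2 \<delta>, 1 - 2 \<delta>], well inside the margin \<delta> that the kernel needs.\<close>
  define a where "a = 1 - 4 * \<delta>"
  define T where "T x = a *\<^sub>R x + (\<chi> i. 2 * \<delta>)" for x :: "real ^ 'd"
  have a: "0 < a" "a \<le> 1" using \<delta> by (auto simp: a_def)
  have T: "\<delta> < T x $ i" "T x $ i < 1 - \<delta>" "\<bar>T x $ i - x $ i\<bar> \<le> 2 * \<delta>" if "x \<in> cbox 0 1" for x i
  proof -
    have x: "0 \<le> x $ i" "x $ i \<le> 1" using that by (auto simp: mem_box_cart)
    have "0 \<le> a * x $ i" "a * x $ i \<le> a * 1" using x a by (auto intro: mult_left_mono)
    moreover have "0 \<le> \<delta> * x $ i" "\<delta> * x $ i \<le> \<delta> * 1" using x \<delta> by (auto intro: mult_left_mono)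
    moreover have "T x $ i = a * x $ i + 2 * \<delta>" "T x $ i - x $ i = 2 * \<delta> - 4 * (\<delta> * x $ i)"
      by (simp_all add: T_def a_def algebra_simps)
    ultimately show "\<delta> < T x $ i" "T x $ i < 1 - \<delta>" "\<bar>T x $ i - x $ i\<bar> \<le> 2 * \<delta>"
      using \<delta> a_def by linarith+
  qed
  \<comment> \<open>Taylor coefficients of the mollification at \<open>T z\<close> for the increment
    \<open>a *\<^sub>R (x - z)\<close>: the powers of \<open>a\<close> come from homogeneity, and
    \<open>I\<close> normalises the mass of the kernel.\<close>
  define c where "c is z = mollified r f (count_list is) (T z) / fact (length is) * a ^ length is / I"
    for "is" z
  have "\<bar>f x - (\<Sum>k<n. \<Sum>is | length is = k. c is z * direction_monomial (x - z) is)\<bar>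
      \<le> \<eta> + (\<Sum>i\<in>UNIV. \<bar>x $ i - z $ i\<bar>) ^ n" if xz: "x \<in> cbox 0 1" "z \<in> cbox 0 1" for x z
  proof -
    let ?P = "\<Sum>k<n. \<Sum>is | length is = k. c is z * direction_monomial (x - z) is"
    let ?v = "a *\<^sub>R (x - z)" and ?s = "\<Sum>i\<in>UNIV. \<bar>x $ i - z $ i\<bar>"
    have Tv: "T z + t *\<^sub>R ?v = T (z + t *\<^sub>R (x - z))" for t
      by (simp add: T_def algebra_simps)
    have "\<bar>mollified r f (\<lambda>_. 0) (T x) - f x * mollified r (\<lambda>_. 1) (\<lambda>_. 0) (T x)\<bar>
        \<le> \<eta> * mollified r (\<lambda>_. 1) (\<lambda>_. 0) (T x)"
    proof (rule mollified_close[OF f(1) r(1,4,2)])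
      fix y assume y: "y \<in> cbox 0 1" "\<And>i. \<bar>y $ i - T x $ i\<bar> < \<delta>"
      have "norm (y - x) \<le> (\<Sum>i\<in>UNIV. \<bar>(y - x) $ i\<bar>)"
        by (rule norm_le_l1_cart)
      also have "\<dots> \<le> (\<Sum>i\<in>(UNIV :: 'd set). 3 * \<delta>)"
      proof (rule sum_mono)
        fix i show "\<bar>(y - x) $ i\<bar> \<le> 3 * \<delta>"
          using y(2)[of i] T(3)[OF xz(1), of i] by simp
      qed
      also have "\<dots> < \<delta>\<^sub>0" using \<delta>(3) by simp
      finally have "dist (f y) (f x) < \<eta>"
        by (intro \<delta>\<^sub>0(2) xz y) (simp add: dist_norm)
      then show "\<bar>f y - f x\<bar> \<le> \<eta>" by (simp add: dist_real_def)
    qed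
    then have 1: "\<bar>mollified r f (\<lambda>_. 0) (T x) - f x * I\<bar> \<le> \<eta> * I"
      using I(2)[OF T(1,2)[OF xz(1)]] by simp
    have "\<bar>mollified r f (\<lambda>_. 0) (T z + ?v) - (\<Sum>k<n. \<Sum>is | length is = k.
           mollified r f (count_list is) (T z) / fact k * direction_monomial ?v is)\<bar>
         \<le> I * (\<Sum>i\<in>UNIV. \<bar>?v $ i\<bar>) ^ n / fact n"
    proof (rule mollified_taylor[OF f(1) r(1)])
      fix "is" :: "'d list" and t :: real assume "is": "length is = n" and t: "0 \<le> t" "t \<le> 1"
      \<comment> \<open>The segment from \<open>T z\<close> to \<open>T x\<close> is the image of
        the segment from \<open>z\<close> to \<open>x\<close>, which stays in the cube by convexity;
        so the derivative bound \<open>I\<close> holds all along it.\<close>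
      have "z + t *\<^sub>R (x - z) = (1 - t) *\<^sub>R z + t *\<^sub>R x"
        by (simp add: algebra_simps)
      then have in_cube: "z + t *\<^sub>R (x - z) \<in> cbox 0 1"
        using convexD[OF convex_box(1) xz(2,1), of "1 - t" t] t by simp
      have "mi_order (count_list is) \<le> n"
        using "is" sum_count_set[of "is" UNIV] by (simp add: mi_order_def)
      from mollified_bound[OF f this r(1,4,2) \<delta>(1) T(1,2)[OF in_cube]]
      show "\<bar>mollified r f (count_list is) (T z + t *\<^sub>R ?v)\<bar> \<le> I"
        unfolding Tv using I(2)[OF T(1,2)[OF in_cube]] by simp
    qed
    moreover have "T z + ?v = T x"
      using Tv[of 1] by simp
    moreover have "(\<Sum>k<n. \<Sum>is | length is = k.
           mollified r f (count_list is) (T z) / fact k * direction_monomial ?v is) = I * ?P"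
      using I(1) by (simp add: c_def sum_distrib_left direction_monomial_scaleR mult_ac)
    moreover have "I * (\<Sum>i\<in>UNIV. \<bar>?v $ i\<bar>) ^ n / fact n \<le> I * ?s ^ n"
    proof -
      have "(\<Sum>i\<in>UNIV. \<bar>?v $ i\<bar>) \<le> ?s"
        using a by (intro sum_mono) (simp add: abs_mult mult_left_le_one_le)
      then have "(\<Sum>i\<in>UNIV. \<bar>?v $ i\<bar>) ^ n \<le> ?s ^ n"
        by (intro power_mono sum_nonneg) auto
      then have "(\<Sum>i\<in>UNIV. \<bar>?v $ i\<bar>) ^ n / fact n \<le> ?s ^ n / 1"
        by (intro frac_le) (auto intro!: sum_nonneg)
      then show ?thesis using I(1) by (simp add: mult_left_mono flip: times_divide_eq_right)
    qed
    ultimately have 2: "\<bar>mollified r f (\<lambda>_. 0) (T x) - I * ?P\<bar> \<le> I * ?s ^ n"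
      by simp
    have "I * \<bar>f x - ?P\<bar> = \<bar>I * (f x - ?P)\<bar>"
      using I(1) by (simp add: abs_mult)
    also have "\<dots> = \<bar>f x * I - I * ?P\<bar>"
      by (simp add: right_diff_distrib mult.commute)
    also have "\<dots> \<le> I * (\<eta> + ?s ^ n)"
      using 1 2 by (simp add: algebra_simps)
    finally show ?thesis
      using I(1) by simp
  qed
  then show thesis using that by blast
qed

section \<open>Networks as layers of functions\<close>

definition affine_comb :: "('a \<Rightarrow> real) set \<Rightarrow> ('a \<Rightarrow> real) \<Rightarrow> bool" where
  "affine_comb F u \<longleftrightarrow> (\<exists>w b. \<forall>x. u x = (\<Sum>\<psi>\<in>F. w \<psi> * \<psi> x) + b)"

definition coordinates :: "(real ^ 'd \<Rightarrow> real) set" where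
  "coordinates = range (\<lambda>i x. x $ i)"

text \<open>Neurons are identified with the functions that they compute, so that networks are put
  side by side by taking unions of their layers. The parameter \<open>k\<close> bounds the fan-in.\<close>

definition neuron_chain ::
  "(nat \<Rightarrow> activation) \<Rightarrow> nat \<Rightarrow> nat \<Rightarrow> (nat \<Rightarrow> (real ^ 'd::finite \<Rightarrow> real) set) \<Rightarrow> bool" where
  "neuron_chain \<sigma> L k F \<longleftrightarrow> F 0 = coordinates \<and> (\<forall>l\<le>L. finite (F l)) \<and>
     (\<forall>l<L. \<forall>\<phi>\<in>F (Suc l). \<exists>D u. D \<subseteq> F l \<and> card D \<le> k \<and> affine_comb D u \<and>
        \<phi> = (\<lambda>x. activate (\<sigma> l) (u x)))"

lemma neuron_chain_0: "neuron_chain \<sigma> L k F \<Longrightarrow> F 0 = coordinates"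
  and neuron_chain_finite: "neuron_chain \<sigma> L k F \<Longrightarrow> l \<le> L \<Longrightarrow> finite (F l)"
  unfolding neuron_chain_def by simp_all

lemma neuron_chain_step:
  assumes "neuron_chain \<sigma> L k F" "l < L" "\<phi> \<in> F (Suc l)"
  obtains D u where "D \<subseteq> F l" "card D \<le> k" "affine_comb D u" "\<phi> = (\<lambda>x. activate (\<sigma> l) (u x))"
proof -
  have "\<exists>D u. D \<subseteq> F l \<and> card D \<le> k \<and> affine_comb D u \<and> \<phi> = (\<lambda>x. activate (\<sigma> l) (u x))"
    using assms(2,3) by (rule bspec[OF mp[OF spec[OF conjunct2[OF conjunct2[OF assms(1)[unfolded neuron_chain_def]]]]]])
  then show thesis
    using that by (elim exE conjE)
qed

lemma neuron_chainI:
  assumes "F 0 = coordinates" "\<And>l. l \<le> L \<Longrightarrow> finite (F l)"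
    and "\<And>l \<phi>. l < L \<Longrightarrow> \<phi> \<in> F (Suc l) \<Longrightarrow> \<exists>D u. D \<subseteq> F l \<and> card D \<le> k \<and> affine_comb D u \<and>
        \<phi> = (\<lambda>x. activate (\<sigma> l) (u x))"
  shows "neuron_chain \<sigma> L k F"
  unfolding neuron_chain_def by (intro conjI allI impI ballI assms)

lemma card_coordinates: "card (coordinates :: (real ^ 'd::finite \<Rightarrow> real) set) = CARD('d)"
proof -
  have "inj (\<lambda>i (x :: real ^ 'd). x $ i)"
  proof (rule injI)
    fix i j assume "(\<lambda>x :: real ^ 'd. x $ i) = (\<lambda>x. x $ j)"
    then have "axis i (1::real) $ i = axis i 1 $ j" by metis
    then show "i = j" by (simp add: axis_def split: if_splits)
  qed
  then show ?thesis
    by (simp add: coordinates_def card_image)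
qed

lemma finite_coordinates [simp]: "finite (coordinates :: (real ^ 'd::finite \<Rightarrow> real) set)"
  by (simp add: coordinates_def)

text \<open>Numbering the functions of each layer turns them into neurons, and only the connections
  from the chosen sets \<open>D\<close> are present. A neuron then costs at most \<open>k\<close>
  weights and a bias, while the output layer reads all of \<open>F L\<close>.\<close>

lemma network_of_neuron_chain:
  fixes F :: "nat \<Rightarrow> (real ^ 'd::finite \<Rightarrow> real) set"
  assumes F: "neuron_chain \<sigma> L k F" and out: "affine_comb (F L) out"
  obtains A a where "is_architecture CARD('d) A"
    "num_params A \<le> (\<Sum>l<L. card (F (Suc l)) * Suc k) + card (F L) + 1"
    "\<And>x. network A a x = out x"
proof -
  have F0: "F 0 = coordinates" and fin: "\<And>l. l \<le> L \<Longrightarrow> finite (F l)"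
    using F by (auto simp: neuron_chain_def)
  \<comment> \<open>In layer 0 the numbering is prescribed: it must be the enumeration of the
    coordinates used by \<open>input_layer\<close>.\<close>
  have "\<exists>e. bij_betw e {..<card (F l)} (F l) \<and> (l = 0 \<longrightarrow> (\<forall>j x. e j x = input_layer x j))" if "l \<le> L" for l
  proof (cases "l = 0")
    case True
    have "bij_betw (from_nat_into UNIV) {..<CARD('d)} (UNIV :: 'd set)"
      by (rule bij_betw_from_nat_into_finite) simp
    then have "(\<lambda>j x. input_layer x j) ` {..<CARD('d)} = (coordinates :: (real ^ 'd \<Rightarrow> real) set)"
      by (auto simp: input_layer_def[abs_def] coordinates_def bij_betw_def image_iff) (metis UNIV_I imageE)
    moreover from this have "inj_on (\<lambda>j (x :: real ^ 'd). input_layer x j) {..<CARD('d)}"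
      by (intro eq_card_imp_inj_on) (simp_all add: card_coordinates)
    ultimately show ?thesis
      using True by (intro exI[of _ "\<lambda>j x. input_layer x j"]) (simp add: F0 card_coordinates bij_betw_def)
  next
    case False
    then show ?thesis
      using ex_bij_betw_nat_finite[OF fin[OF that]] by (simp add: atLeast0LessThan)
  qed
  then have "\<forall>l. \<exists>e. l \<le> L \<longrightarrow> bij_betw e {..<card (F l)} (F l) \<and> (l = 0 \<longrightarrow> (\<forall>j x. e j x = input_layer x j))"
    by blast
  from choice[OF this] obtain e where e':
    "\<forall>l. l \<le> L \<longrightarrow> bij_betw (e l) {..<card (F l)} (F l) \<and> (l = 0 \<longrightarrow> (\<forall>j x. e l j x = input_layer x j))" ..
  then have e: "bij_betw (e l) {..<card (F l)} (F l)" if "l \<le> L" for l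
    using that by simp
  have e0: "e 0 j x = input_layer x j" for j x
    using e' by blast
  define is_input where "is_input l \<phi> D w b \<longleftrightarrow> D \<subseteq> F l \<and> card D \<le> k \<and>
    \<phi> = (\<lambda>x. activate (\<sigma> l) ((\<Sum>\<psi>\<in>D. w \<psi> * \<psi> x) + b))" for l \<phi> D and w :: "_ \<Rightarrow> real" and b
  have "\<exists>D w b. is_input l \<phi> D w b" if l\<phi>: "l < L" "\<phi> \<in> F (Suc l)" for l \<phi>
  proof -
    obtain D u where D: "D \<subseteq> F l" "card D \<le> k" "affine_comb D u"
      and \<phi>: "\<phi> = (\<lambda>x. activate (\<sigma> l) (u x))"
      by (rule neuron_chain_step[OF F l\<phi>])
    from D(3) obtain w b where "\<forall>x. u x = (\<Sum>\<psi>\<in>D. w \<psi> * \<psi> x) + b"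
      unfolding affine_comb_def by blast
    then have "is_input l \<phi> D w b" using D(1,2) \<phi> by (simp add: is_input_def)
    then show ?thesis by blast
  qed
  then obtain D w b where Dwb: "\<And>l \<phi>. l < L \<Longrightarrow> \<phi> \<in> F (Suc l) \<Longrightarrow> is_input l \<phi> (D l \<phi>) (w l \<phi>) (b l \<phi>)"
    by metis
  have D: "D l \<phi> \<subseteq> F l" "card (D l \<phi>) \<le> k"
    and wb: "\<phi> = (\<lambda>x. activate (\<sigma> l) ((\<Sum>\<psi>\<in>D l \<phi>. w l \<phi> \<psi> * \<psi> x) + b l \<phi>))"
    if "l < L" "\<phi> \<in> F (Suc l)" for l \<phi>
    using Dwb[OF that] by (simp_all add: is_input_def)
  obtain wo bo where o: "\<And>x. out x = (\<Sum>\<psi>\<in>F L. wo \<psi> * \<psi> x) + bo"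
    using out unfolding affine_comb_def by blast
  define A where "A = \<lparr>depth = L, width = (\<lambda>l. if l \<le> L then card (F l) else 1),
    links = (\<lambda>l. if l < L then {(i, j). i < card (F l) \<and> j < card (F (Suc l)) \<and> e l i \<in> D l (e (Suc l) j)}
                 else {..<card (F L)} \<times> {0}), activ = \<sigma>\<rparr>"
  define a where "a = (\<lambda>p. case p of
      Weight l i j \<Rightarrow> if l < L then w l (e (Suc l) j) (e l i) else wo (e L i)
    | Bias l j \<Rightarrow> if l < L then b l (e (Suc l) j) else bo)"
  have "is_architecture CARD('d) A"
    by (auto simp: is_architecture_def A_def F0 card_coordinates)
  moreover have hid: "hidden A a (input_layer x) l j = e l j x" if "l \<le> L" "j < card (F l)" for x l j
    using that
  proof (induction l arbitrary: j)
    case 0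
    then show ?case by (simp add: e0)
  next
    case (Suc l)
    let ?\<phi> = "e (Suc l) j"
    have l: "l < L" and \<phi>: "?\<phi> \<in> F (Suc l)"
      using Suc.prems e[of "Suc l"] by (auto simp: bij_betw_def)
    have "bij_betw (e l) {i. i < card (F l) \<and> e l i \<in> D l ?\<phi>} (D l ?\<phi>)"
      using e[of l] D(1)[OF l \<phi>] l
      by (auto simp: bij_betw_def inj_on_def image_iff subset_iff)
    then have "(\<Sum>\<psi>\<in>D l ?\<phi>. w l ?\<phi> \<psi> * \<psi> x) =
        (\<Sum>i | i < card (F l) \<and> e l i \<in> D l ?\<phi>. w l ?\<phi> (e l i) * e l i x)"
      by (rule sum.reindex_bij_betw[symmetric])
    also have "\<dots> = (\<Sum>i | (i, j) \<in> links A l. a (Weight l i j) * hidden A a (input_layer x) l i)"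
    proof (rule sum.cong)
      show "{i. i < card (F l) \<and> e l i \<in> D l ?\<phi>} = {i. (i, j) \<in> links A l}"
        using Suc.prems l by (auto simp: A_def)
      show "w l ?\<phi> (e l i) * e l i x = a (Weight l i j) * hidden A a (input_layer x) l i"
        if "i \<in> {i. (i, j) \<in> links A l}" for i
      proof -
        have "i < card (F l)" using that l by (simp add: A_def)
        then show ?thesis using Suc.IH[of i] l by (simp add: a_def)
      qed
    qed
    finally have "affine_layer A a l (hidden A a (input_layer x) l) j
        = (\<Sum>\<psi>\<in>D l ?\<phi>. w l ?\<phi> \<psi> * \<psi> x) + b l ?\<phi>"
      using l by (simp add: affine_layer_def a_def)
    moreover have "activ A l = \<sigma> l" by (simp add: A_def)
    ultimately show ?case
      using fun_cong[OF wb[OF l \<phi>], of x] by simp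
  qed
  moreover have "network A a x = out x" for x
  proof -
    have "(\<Sum>\<psi>\<in>F L. wo \<psi> * \<psi> x) = (\<Sum>i<card (F L). wo (e L i) * e L i x)"
      by (rule sum.reindex_bij_betw[OF e, symmetric]) simp
    also have "\<dots> = (\<Sum>i | (i, 0) \<in> links A L. a (Weight L i 0) * hidden A a (input_layer x) L i)"
    proof (rule sum.cong)
      show "{..<card (F L)} = {i. (i, 0) \<in> links A L}"
        by (auto simp: A_def)
      show "wo (e L i) * e L i x = a (Weight L i 0) * hidden A a (input_layer x) L i"
        if "i \<in> {i. (i, 0) \<in> links A L}" for i
      proof -
        have "i < card (F L)" using that by (simp add: A_def)
        then show ?thesis using hid[of L i x] by (simp add: a_def)
      qed
    qed
    moreover have "a (Bias L 0) = bo" "depth A = L"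
      by (simp_all add: a_def A_def)
    ultimately show ?thesis
      by (simp add: network_def affine_layer_def o)
  qed
  moreover have "num_params A \<le> (\<Sum>l<L. card (F (Suc l)) * Suc k) + card (F L) + 1"
  proof -
    \<comment> \<open>The parameters of neuron \<open>j\<close> of layer \<open>l + 1\<close>. The
      weights are written as an image of the source set, so that its cardinality bounds their
      number.\<close>
    define S where "S l j = insert (Bias l j) ((\<lambda>\<psi>. Weight l (inv_into {..<card (F l)} (e l) \<psi>) j) ` D l (e (Suc l) j))"
      for l j
    let ?O = "insert (Bias L 0) ((\<lambda>i. Weight L i 0) ` {..<card (F L)})"
    have inF: "e (Suc l) j \<in> F (Suc l)" if "l < L" "j < card (F (Suc l))" for l j
      using that e[of "Suc l"] by (auto simp: bij_betw_def)
    have finD: "finite (D l (e (Suc l) j))" if "l < L" "j < card (F (Suc l))" for l j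
      using that inF D(1) fin by (meson finite_subset less_imp_le)
    have sub: "slots A \<subseteq> (\<Union>l<L. \<Union>j<card (F (Suc l)). S l j) \<union> ?O"
    proof
      fix p assume "p \<in> slots A"
      then consider (W) l i j where "p = Weight l i j" "l \<le> L" "(i, j) \<in> links A l"
        | (B) l j where "p = Bias l j" "l \<le> L" "j < width A (Suc l)"
        by (auto simp: slots_def A_def)
      then show "p \<in> (\<Union>l<L. \<Union>j<card (F (Suc l)). S l j) \<union> ?O"
      proof cases
        case W
        show ?thesis
        proof (cases "l < L")
          case True
          then have ij: "i < card (F l)" "j < card (F (Suc l))" "e l i \<in> D l (e (Suc l) j)"
            using W(3) by (auto simp: A_def)
          have "inv_into {..<card (F l)} (e l) (e l i) = i"
            using e[of l] True ij(1) by (intro inv_into_f_f) (auto simp: bij_betw_def)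
          then have "p \<in> S l j"
            using ij(3) W(1) unfolding S_def by (metis image_eqI insertCI)
          then show ?thesis using True ij(2) by blast
        next
          case False
          then show ?thesis using W by (auto simp: A_def)
        qed
      next
        case B
        then show ?thesis
          by (cases "l < L") (auto simp: A_def S_def not_less)
      qed
    qed
    have cS: "finite (S l j)" "card (S l j) \<le> Suc k" if "l < L" "j < card (F (Suc l))" for l j
    proof -
      show "finite (S l j)" using finD[OF that] by (simp add: S_def)
      have "card (S l j) \<le> Suc (card ((\<lambda>\<psi>. Weight l (inv_into {..<card (F l)} (e l) \<psi>) j) ` D l (e (Suc l) j)))"
        unfolding S_def by (rule card_insert_le_m1) simp_all
      also have "\<dots> \<le> Suc (card (D l (e (Suc l) j)))"
        using finD[OF that] by (simp add: card_image_le)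
      also have "\<dots> \<le> Suc k" using D(2)[OF that(1) inF[OF that]] by simp
      finally show "card (S l j) \<le> Suc k" .
    qed
    have "card (slots A) \<le> card ((\<Union>l<L. \<Union>j<card (F (Suc l)). S l j) \<union> ?O)"
      using cS(1) by (intro card_mono sub) auto
    also have "\<dots> \<le> card (\<Union>l<L. \<Union>j<card (F (Suc l)). S l j) + card ?O"
      by (rule card_Un_le)
    also have "card (\<Union>l<L. \<Union>j<card (F (Suc l)). S l j) \<le> (\<Sum>l<L. card (\<Union>j<card (F (Suc l)). S l j))"
      by (rule card_UN_le) simp
    also have "\<dots> \<le> (\<Sum>l<L. \<Sum>j<card (F (Suc l)). card (S l j))"
      by (intro sum_mono card_UN_le) simp
    also have "\<dots> \<le> (\<Sum>l<L. \<Sum>j<card (F (Suc l)). Suc k)"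
      using cS(2) by (intro sum_mono) auto
    also have "card ?O \<le> card (F L) + 1"
      by (rule order_trans[OF card_insert_le_m1]) (auto intro: card_image_le[THEN order_trans])
    finally show ?thesis by (simp add: num_params_def)
  qed
  ultimately show thesis using that by blast
qed

section \<open>Affine combinations and parallel composition\<close>

lemma affine_comb_mono:
  assumes "affine_comb D u" "D \<subseteq> F" "finite F"
  shows "affine_comb F u"
proof -
  obtain w b where w: "\<And>x. u x = (\<Sum>\<psi>\<in>D. w \<psi> * \<psi> x) + b"
    using assms(1) unfolding affine_comb_def by blast
  have "(\<Sum>\<psi>\<in>F. (if \<psi> \<in> D then w \<psi> else 0) * \<psi> x) = (\<Sum>\<psi>\<in>D. w \<psi> * \<psi> x)" for x
    using assms(2,3) by (intro sum.mono_neutral_cong_right) auto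
  then have "\<forall>x. u x = (\<Sum>\<psi>\<in>F. (if \<psi> \<in> D then w \<psi> else 0) * \<psi> x) + b"
    using w by simp
  then show ?thesis
    unfolding affine_comb_def by (intro exI)
qed

lemma affine_comb_linear:
  assumes "affine_comb F u" "affine_comb F v"
  shows "affine_comb F (\<lambda>x. p * u x + q * v x + c)"
proof -
  obtain w b w' b' where "\<And>x. u x = (\<Sum>\<psi>\<in>F. w \<psi> * \<psi> x) + b" "\<And>x. v x = (\<Sum>\<psi>\<in>F. w' \<psi> * \<psi> x) + b'"
    using assms unfolding affine_comb_def by blast
  then have "\<forall>x. p * u x + q * v x + c
      = (\<Sum>\<psi>\<in>F. (p * w \<psi> + q * w' \<psi>) * \<psi> x) + (p * b + q * b' + c)"
    by (simp add: algebra_simps sum.distrib sum_distrib_left)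
  then show ?thesis
    unfolding affine_comb_def by (intro exI)
qed

lemma affine_comb_const: "affine_comb F (\<lambda>_. c)"
  unfolding affine_comb_def by (rule exI[of _ "\<lambda>_. 0"]) auto

lemma affine_comb_self: "affine_comb {\<psi>} \<psi>"
  unfolding affine_comb_def by (rule exI[of _ "\<lambda>_. 1"]) auto

lemma affine_comb_sum:
  assumes "finite J" "\<And>j. j \<in> J \<Longrightarrow> affine_comb F (g j)"
  shows "affine_comb F (\<lambda>x. \<Sum>j\<in>J. g j x)"
  using assms
proof (induction J rule: finite_induct)
  case (insert j J)
  then show ?case
    using affine_comb_linear[of F "g j" "\<lambda>x. \<Sum>j\<in>J. g j x" 1 1 0] by simp
qed (simp add: affine_comb_const)

lemma neuron_chain_mono:
  assumes "neuron_chain \<sigma> L k F" "k \<le> k'"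
  shows "neuron_chain \<sigma> L k' F"
proof (rule neuron_chainI)
  fix l \<phi> assume "l < L" "\<phi> \<in> F (Suc l)"
  then obtain D u where "D \<subseteq> F l" "card D \<le> k" "affine_comb D u" "\<phi> = (\<lambda>x. activate (\<sigma> l) (u x))"
    by (rule neuron_chain_step[OF assms(1)])
  then show "\<exists>D u. D \<subseteq> F l \<and> card D \<le> k' \<and> affine_comb D u \<and> \<phi> = (\<lambda>x. activate (\<sigma> l) (u x))"
    using assms(2) by (intro exI[of _ D] exI[of _ u]) simp
qed (use assms(1) in \<open>simp_all add: neuron_chain_0 neuron_chain_finite\<close>)

text \<open>Each neuron keeps its own sources, so parallel composition does not raise the fan-in.
  Layer 0 is set separately, since an empty union would lose the inputs.\<close>

lemma neuron_chain_Union: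
  assumes "finite J" "\<And>j. j \<in> J \<Longrightarrow> neuron_chain \<sigma> L k (F j)"
  shows "neuron_chain \<sigma> L k (\<lambda>l. if l = 0 then coordinates else \<Union>j\<in>J. F j l)"
proof (rule neuron_chainI)
  fix l \<phi> assume l: "l < L" and \<phi>: "\<phi> \<in> (if Suc l = 0 then coordinates else \<Union>j\<in>J. F j (Suc l))"
  then obtain j where j: "j \<in> J" "\<phi> \<in> F j (Suc l)" by auto
  obtain D u where D: "D \<subseteq> F j l" "card D \<le> k" "affine_comb D u" "\<phi> = (\<lambda>x. activate (\<sigma> l) (u x))"
    by (rule neuron_chain_step[OF assms(2)[OF j(1)] l j(2)])
  have "F j l \<subseteq> (if l = 0 then coordinates else \<Union>j\<in>J. F j l)"
    using j(1) neuron_chain_0[OF assms(2)[OF j(1)]] by auto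
  with D(1) have "D \<subseteq> (if l = 0 then coordinates else \<Union>j\<in>J. F j l)"
    by (rule subset_trans)
  with D(2-4) show "\<exists>D u. D \<subseteq> (if l = 0 then coordinates else \<Union>j\<in>J. F j l) \<and> card D \<le> k \<and>
      affine_comb D u \<and> \<phi> = (\<lambda>x. activate (\<sigma> l) (u x))"
    by (intro exI[of _ D] exI[of _ u] conjI)
qed (use assms(1) neuron_chain_finite[OF assms(2)] in auto)

section \<open>Functions computed by networks of bounded size\<close>

definition relu_square :: "nat \<Rightarrow> activation" where
  "relu_square l = (if l = 0 then ReLU else Square)"

text \<open>The number \<open>s\<close> bounds both the fan-in and the width of the hidden layers.
  The depth is exactly \<open>L\<close>, so that layers of different networks match. Agreement is
  asked on the cube, where a coordinate passes unchanged through a single ReLU neuron.\<close>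

definition computable :: "nat \<Rightarrow> nat \<Rightarrow> (real ^ 'd::finite \<Rightarrow> real) \<Rightarrow> bool" where
  "computable s L u \<longleftrightarrow> (\<exists>F v. neuron_chain relu_square L s F \<and> (\<forall>l. 1 \<le> l \<longrightarrow> l \<le> L \<longrightarrow> card (F l) \<le> s) \<and>
     affine_comb (F L) v \<and> (\<forall>x\<in>cbox 0 1. u x = v x))"

lemma computableE:
  assumes "computable s L u"
  obtains F v where "neuron_chain relu_square L s F" "\<forall>l. 1 \<le> l \<longrightarrow> l \<le> L \<longrightarrow> card (F l) \<le> s"
    "affine_comb (F L) v" "\<forall>x\<in>cbox 0 1. u x = v x"
  using assms unfolding computable_def by (elim exE conjE)

lemma computableI:
  assumes "neuron_chain relu_square L s F" "\<And>l. 1 \<le> l \<Longrightarrow> l \<le> L \<Longrightarrow> card (F l) \<le> s"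
    "affine_comb (F L) v" "\<And>x. x \<in> cbox 0 1 \<Longrightarrow> u x = v x"
  shows "computable s L u"
  unfolding computable_def by (rule exI[of _ F], rule exI[of _ v]) (simp add: assms)

lemma computable_cong:
  assumes "computable s L u" "\<And>x. x \<in> cbox 0 1 \<Longrightarrow> v x = u x"
  shows "computable s L v"
proof -
  obtain F w where F: "neuron_chain relu_square L s F" "\<forall>l. 1 \<le> l \<longrightarrow> l \<le> L \<longrightarrow> card (F l) \<le> s"
    "affine_comb (F L) w" "\<forall>x\<in>cbox 0 1. u x = w x"
    by (rule computableE[OF assms(1)])
  show ?thesis
    by (rule computableI[OF F(1) _ F(3)]) (simp_all add: F(2,4) assms(2))
qed

lemma computable_mono:
  assumes "computable s L u" "s \<le> t"
  shows "computable t L u"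
proof -
  obtain F v where F: "neuron_chain relu_square L s F" "\<forall>l. 1 \<le> l \<longrightarrow> l \<le> L \<longrightarrow> card (F l) \<le> s"
    "affine_comb (F L) v" "\<forall>x\<in>cbox 0 1. u x = v x"
    by (rule computableE[OF assms(1)])
  show ?thesis
    by (rule computableI[OF neuron_chain_mono[OF F(1) assms(2)] _ F(3)])
       (use F(2,4) assms(2) in \<open>auto intro: order_trans\<close>)
qed

lemma neuron_chain_empty: "neuron_chain \<sigma> L k (\<lambda>l. if l = 0 then coordinates else {})"
  by (rule neuron_chainI) auto

lemma computable_const: "computable 0 L (\<lambda>_. c)"
  by (rule computableI[OF neuron_chain_empty _ affine_comb_const]) auto

text \<open>The joint chain keeps fan-in \<open>s\<close>; only its width grows with
  \<open>card J\<close>. This makes the final parameter count linear in the number of grid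
  points.\<close>

lemma computable_family:
  assumes "finite J" "L \<ge> 1" "\<And>j. j \<in> J \<Longrightarrow> computable s L (g j)"
  obtains F v where "neuron_chain relu_square L s F"
    "\<And>l. 1 \<le> l \<Longrightarrow> l \<le> L \<Longrightarrow> card (F l) \<le> card J * s"
    "\<And>j. j \<in> J \<Longrightarrow> affine_comb (F L) (v j)" "\<And>j x. j \<in> J \<Longrightarrow> x \<in> cbox 0 1 \<Longrightarrow> g j x = v j x"
proof -
  define realizes where "realizes j F v \<longleftrightarrow> neuron_chain relu_square L s F \<and>
    (\<forall>l. 1 \<le> l \<longrightarrow> l \<le> L \<longrightarrow> card (F l) \<le> s) \<and> affine_comb (F L) v \<and>
    (\<forall>x\<in>cbox 0 1. g j x = v x)" for j F v
  have "\<exists>F v. realizes j F v" if "j \<in> J" for j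
    using assms(3)[OF that] unfolding computable_def realizes_def .
  then obtain F v where "\<And>j. j \<in> J \<Longrightarrow> realizes j (F j) (v j)"
    by metis
  then have F: "\<And>j. j \<in> J \<Longrightarrow> neuron_chain relu_square L s (F j)"
    and c: "\<And>j l. j \<in> J \<Longrightarrow> 1 \<le> l \<Longrightarrow> l \<le> L \<Longrightarrow> card (F j l) \<le> s"
    and v: "\<And>j. j \<in> J \<Longrightarrow> affine_comb (F j L) (v j)"
    and g: "\<And>j x. j \<in> J \<Longrightarrow> x \<in> cbox 0 1 \<Longrightarrow> g j x = v j x"
    by (auto simp: realizes_def)
  let ?F = "\<lambda>l. if l = 0 then coordinates else \<Union>j\<in>J. F j l"
  have chain: "neuron_chain relu_square L s ?F"
    by (rule neuron_chain_Union[OF assms(1) F])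
  moreover have "card (?F l) \<le> card J * s" if "1 \<le> l" "l \<le> L" for l
  proof -
    have "card (?F l) \<le> (\<Sum>j\<in>J. card (F j l))"
      using that card_UN_le[OF assms(1)] by simp
    also have "\<dots> \<le> (\<Sum>j\<in>J. s)" using c that by (intro sum_mono) auto
    finally show ?thesis by simp
  qed
  moreover have "affine_comb (?F L) (v j)" if "j \<in> J" for j
  proof (rule affine_comb_mono[OF v[OF that]])
    show "finite (?F L)" using chain by (rule neuron_chain_finite) simp
  qed (use that assms(2) in auto)
  ultimately show thesis using that g by blast
qed

text \<open>Addition happens in the affine output, so the depth does not change. The fan-in bound
  degrades to \<open>card J * s\<close>, hence this form serves only for sums whose length is fixed
  by the dimension and \<open>n\<close>.\<close>

lemma computable_sum:
  assumes "finite J" "L \<ge> 1" "\<And>j. j \<in> J \<Longrightarrow> computable s L (g j)"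
  shows "computable (card J * s) L (\<lambda>x. \<Sum>j\<in>J. g j x)"
proof (cases "J = {}")
  case True
  then show ?thesis using computable_const[of L 0] by simp
next
  case False
  obtain F v where F: "neuron_chain relu_square L s F"
    "\<And>l. 1 \<le> l \<Longrightarrow> l \<le> L \<Longrightarrow> card (F l) \<le> card J * s"
    and v: "\<And>j. j \<in> J \<Longrightarrow> affine_comb (F L) (v j)"
      "\<And>j x. j \<in> J \<Longrightarrow> x \<in> cbox 0 1 \<Longrightarrow> g j x = v j x"
    using computable_family[where s = s and g = g, OF assms] by blast
  have "s \<le> card J * s"
    using False assms(1) by (simp add: Suc_leI card_gt_0_iff)
  then show ?thesis
    by (rule computableI[OF neuron_chain_mono[OF F(1)] F(2) affine_comb_sum[OF assms(1) v(1)]])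
       (simp_all add: v(2))
qed

lemma computable_affine:
  assumes "computable s L u"
  shows "computable s L (\<lambda>x. p * u x + c)"
proof -
  obtain F v where F: "neuron_chain relu_square L s F" "\<forall>l. 1 \<le> l \<longrightarrow> l \<le> L \<longrightarrow> card (F l) \<le> s"
    "affine_comb (F L) v" "\<forall>x\<in>cbox 0 1. u x = v x"
    by (rule computableE[OF assms])
  have aff: "affine_comb (F L) (\<lambda>x. p * v x + c)"
    using affine_comb_linear[OF F(3,3), of p 0 c] by simp
  show ?thesis
    by (rule computableI[OF F(1) _ aff]) (simp_all add: F(2,4))
qed

lemma computable_add:
  assumes "computable s L u" "computable s L v" "L \<ge> 1"
  shows "computable (2 * s) L (\<lambda>x. u x + v x)"
proof -
  have "computable (card (UNIV :: bool set) * s) L (\<lambda>x. \<Sum>b\<in>UNIV. (if b then u else v) x)"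
    by (rule computable_sum) (use assms in auto)
  then show ?thesis
    by (simp add: UNIV_bool add.commute mult_2)
qed

text \<open>The affine output becomes the input of one new neuron, which reads the whole last layer.
  \<open>L \<ge> 1\<close> puts that neuron into a square layer and makes \<open>s\<close> a bound
  on the layer it reads.\<close>

lemma computable_square:
  assumes "computable s L u" "L \<ge> 1"
  shows "computable (Suc s) (Suc L) (\<lambda>x. (u x)\<^sup>2)"
proof -
  obtain F v where F: "neuron_chain relu_square L s F" "\<forall>l. 1 \<le> l \<longrightarrow> l \<le> L \<longrightarrow> card (F l) \<le> s"
    "affine_comb (F L) v" "\<forall>x\<in>cbox 0 1. u x = v x"
    by (rule computableE[OF assms(1)])
  let ?F = "F(Suc L := {\<lambda>x. (v x)\<^sup>2})"
  have chain: "neuron_chain relu_square (Suc L) (Suc s) ?F"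
  proof (rule neuron_chainI)
    fix l \<phi> assume l: "l < Suc L" and \<phi>: "\<phi> \<in> ?F (Suc l)"
    show "\<exists>D u. D \<subseteq> ?F l \<and> card D \<le> Suc s \<and> affine_comb D u \<and> \<phi> = (\<lambda>x. activate (relu_square l) (u x))"
    proof (cases "l = L")
      case True
      have "\<phi> = (\<lambda>x. activate (relu_square l) (v x))"
        using \<phi> True assms(2) by (simp add: relu_square_def)
      moreover have "card (F L) \<le> Suc s" using F(2) assms(2) by (simp add: le_SucI)
      ultimately show ?thesis using F(3) True by (intro exI[of _ "F L"] exI[of _ v]) auto
    next
      case False
      then have "l < L" "\<phi> \<in> F (Suc l)" using l \<phi> by auto
      then obtain D u where "D \<subseteq> F l" "card D \<le> s" "affine_comb D u" "\<phi> = (\<lambda>x. activate (relu_square l) (u x))"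
        by (rule neuron_chain_step[OF F(1)])
      then show ?thesis
        using l by (intro exI[of _ D] exI[of _ u]) auto
    qed
  qed (use neuron_chain_0[OF F(1)] neuron_chain_finite[OF F(1)] in \<open>auto simp: le_Suc_eq\<close>)
  have aff: "affine_comb (?F (Suc L)) (\<lambda>x. (v x)\<^sup>2)"
    using affine_comb_self by simp
  have card: "card (?F l) \<le> Suc s" if "1 \<le> l" "l \<le> Suc L" for l
    using F(2) that by (auto simp: le_Suc_eq)
  show ?thesis
    by (rule computableI[OF chain card aff]) (simp_all add: F(4))
qed

text \<open>In the size, \<open>2 * s\<close> pays for a sum or a difference, \<open>Suc\<close> for
  the squaring neuron, and the outer 2 for the two squares side by side.\<close>

lemma computable_mult:
  assumes "computable s L u" "computable s L v" "L \<ge> 1"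
  shows "computable (2 * Suc (2 * s)) (Suc L) (\<lambda>x. u x * v x)"
proof -
  have plus: "computable (2 * s) L (\<lambda>x. u x + v x)"
    by (rule computable_add[OF assms])
  have minus: "computable (2 * s) L (\<lambda>x. u x + (- 1 * v x + 0))"
    by (rule computable_add[OF assms(1) computable_affine[OF assms(2)] assms(3)])
  have "computable (2 * Suc (2 * s)) (Suc L)
      (\<lambda>x. (1 / 4 * (u x + v x)\<^sup>2 + 0) + (- (1 / 4) * (u x + (- 1 * v x + 0))\<^sup>2 + 0))"
    by (rule computable_add[OF computable_affine[OF computable_square[OF plus assms(3)]]
          computable_affine[OF computable_square[OF minus assms(3)]]]) simp
  then show ?thesis
    by (rule computable_cong) (simp add: power2_eq_square algebra_simps)
qed

text \<open>A square layer offers no identity, so a value is carried through it as a product with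
  1.\<close>

lemma computable_Suc:
  assumes "computable s L u" "L \<ge> 1"
  shows "computable (2 * Suc (2 * s)) (Suc L) u"
proof (rule computable_cong)
  show "computable (2 * Suc (2 * s)) (Suc L) (\<lambda>x. u x * 1)"
    by (rule computable_mult[OF assms(1) computable_mono[OF computable_const] assms(2)]) simp
qed simp

lemma computable_lift:
  "\<exists>s'. \<forall>u :: real ^ 'd::finite \<Rightarrow> real. computable s 1 u \<longrightarrow> computable s' (Suc q) u"
proof (induction q)
  case 0
  show ?case by (rule exI[of _ s]) simp
next
  case (Suc q)
  then obtain s' where s': "\<forall>u :: real ^ 'd \<Rightarrow> real. computable s 1 u \<longrightarrow> computable s' (Suc q) u" ..
  show ?case
  proof (intro exI allI impI)
    fix u :: "real ^ 'd \<Rightarrow> real" assume "computable s 1 u"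
    then show "computable (2 * Suc (2 * s')) (Suc (Suc q)) u"
      using s' by (intro computable_Suc) simp_all
  qed
qed

text \<open>Each layer multiplies on one factor, which is first carried to the depth of the product
  of the others. The size \<open>s'\<close> is chosen before the factors: it depends on their number
  and on \<open>s\<close> only.\<close>

lemma computable_prod_list:
  "\<exists>s'. \<forall>us :: (real ^ 'd::finite \<Rightarrow> real) list. length us = Suc q \<longrightarrow>
     (\<forall>u\<in>set us. computable s 1 u) \<longrightarrow> computable s' (Suc q) (\<lambda>x. \<Prod>u\<leftarrow>us. u x)"
proof (induction q)
  case 0
  show ?case
  proof (intro exI[of _ s] allI impI)
    fix us :: "(real ^ 'd \<Rightarrow> real) list"
    assume us: "length us = Suc 0" "\<forall>u\<in>set us. computable s 1 u"
    obtain u where "us = [u]"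
      using us(1) by (cases us) simp_all
    then show "computable s (Suc 0) (\<lambda>x. \<Prod>u\<leftarrow>us. u x)"
      using us(2) by simp
  qed
next
  case (Suc q)
  obtain s1 where s1: "\<forall>us :: (real ^ 'd \<Rightarrow> real) list. length us = Suc q \<longrightarrow>
     (\<forall>u\<in>set us. computable s 1 u) \<longrightarrow> computable s1 (Suc q) (\<lambda>x. \<Prod>u\<leftarrow>us. u x)"
    using Suc.IH ..
  obtain s2 where s2: "\<forall>u :: real ^ 'd \<Rightarrow> real. computable s 1 u \<longrightarrow> computable s2 (Suc q) u"
    using computable_lift ..
  let ?s = "max s1 s2"
  show ?case
  proof (intro exI[of _ "2 * Suc (2 * ?s)"] allI impI)
    fix us :: "(real ^ 'd \<Rightarrow> real) list"
    assume us: "length us = Suc (Suc q)" "\<forall>u\<in>set us. computable s 1 u"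
    obtain u vs where uvs: "us = u # vs"
      using us(1) by (cases us) simp_all
    have "computable ?s (Suc q) u"
      by (rule computable_mono[OF s2[rule_format]]) (use us uvs in simp_all)
    moreover have "computable ?s (Suc q) (\<lambda>x. \<Prod>u\<leftarrow>vs. u x)"
      by (rule computable_mono[OF s1[rule_format]]) (use us uvs in simp_all)
    ultimately show "computable (2 * Suc (2 * ?s)) (Suc (Suc q)) (\<lambda>x. \<Prod>u\<leftarrow>us. u x)"
      using computable_mult[of ?s "Suc q" u "\<lambda>x. \<Prod>u\<leftarrow>vs. u x"] uvs by simp
  qed
qed

lemma computable_relu: "computable 1 1 (\<lambda>x :: real ^ 'd::finite. max 0 (p * x $ i + c))"
proof -
  let ?u = "\<lambda>x :: real ^ 'd. p * x $ i + c"
  let ?F = "\<lambda>l :: nat. if l = 0 then coordinates else {\<lambda>x. max 0 (?u x)}"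
  have self: "affine_comb {\<lambda>x. x $ i} (\<lambda>x :: real ^ 'd. x $ i)"
    by (rule affine_comb_self)
  have u: "affine_comb {\<lambda>x. x $ i} ?u"
    using affine_comb_linear[OF self self, of p 0 c] by simp
  have "neuron_chain relu_square 1 1 ?F"
  proof (rule neuron_chainI)
    fix l \<phi> assume "l < (1 :: nat)" "\<phi> \<in> ?F (Suc l)"
    then show "\<exists>D v. D \<subseteq> ?F l \<and> card D \<le> 1 \<and> affine_comb D v \<and> \<phi> = (\<lambda>x. activate (relu_square l) (v x))"
      using u by (intro exI[of _ "{\<lambda>x. x $ i}"] exI[of _ ?u]) (auto simp: relu_square_def coordinates_def)
  qed auto
  then show ?thesis
    by (rule computableI[where v = "\<lambda>x. max 0 (?u x)"]) (simp_all add: affine_comb_self)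
qed

section \<open>Networks for localized polynomials\<close>

text \<open>The function max 0 (1 - |t|), written as a second difference of ReLU.\<close>

definition hat :: "real \<Rightarrow> real" where
  "hat t = max 0 (t + 1) - 2 * max 0 t + max 0 (t - 1)"

lemma hat_nonneg: "hat t \<ge> 0" and hat_eq_0: "\<bar>t\<bar> \<ge> 1 \<Longrightarrow> hat t = 0"
  by (auto simp: hat_def max_def)

text \<open>Second differences telescope: only terms at the two ends survive, and for t between 0
  and N they reduce to (t + 1) - t.\<close>

lemma sum_hat:
  assumes "0 \<le> t" "t \<le> real N"
  shows "(\<Sum>j\<le>N. hat (t - real j)) = 1"
proof -
  have "(\<Sum>j\<le>N. hat (t - real j))
      = max 0 (t + 1) - max 0 t - max 0 (t - real N) + max 0 (t - real N - 1)"
    by (induction N) (simp_all add: hat_def algebra_simps)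
  also have "\<dots> = 1" using assms by simp
  finally show ?thesis .
qed

lemma computable_coordinate: "computable 1 1 (\<lambda>x :: real ^ 'd::finite. x $ i + c)"
proof -
  have "computable 1 1 (\<lambda>x :: real ^ 'd. 1 * max 0 (1 * x $ i + 0) + c)"
    by (intro computable_affine computable_relu)
  then show ?thesis
    by (rule computable_cong) (simp add: mem_box_cart)
qed

lemma computable_hat: "computable 4 1 (\<lambda>x :: real ^ 'd::finite. hat (p * x $ i + c))"
proof -
  have a: "computable 1 1 (\<lambda>x :: real ^ 'd. 1 * max 0 (p * x $ i + (c + 1)) + 0)"
    and b: "computable 1 1 (\<lambda>x :: real ^ 'd. - 2 * max 0 (p * x $ i + c) + 0)"
    by (rule computable_affine[OF computable_relu])+
  have 1: "computable 2 1 (\<lambda>x :: real ^ 'd. (1 * max 0 (p * x $ i + (c + 1)) + 0) + (- 2 * max 0 (p * x $ i + c) + 0))"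
    using computable_add[OF a b] by simp
  have 2: "computable 2 1 (\<lambda>x :: real ^ 'd. max 0 (p * x $ i + (c - 1)))"
    by (rule computable_mono[OF computable_relu]) simp
  show ?thesis
    using computable_add[OF 1 2] by (simp add: hat_def algebra_simps)
qed

text \<open>The size is chosen before \<open>p\<close>, \<open>m\<close>, \<open>z\<close> and
  \<open>c\<close>. Through these the mesh, the grid point and the approximated function enter, and
  they affect weights and biases only.\<close>

lemma computable_localized_polynomial:
  "\<exists>s. \<forall>p (m :: 'd::finite \<Rightarrow> real) z c. computable s (CARD('d) + n) (\<lambda>x :: real ^ 'd.
     (\<Prod>i\<in>UNIV. hat (p * x $ i - m i)) *
     (\<Sum>k<n. \<Sum>is | length is = k. c is * direction_monomial (x - z) is))"
proof -
  obtain q where q: "CARD('d) + n = Suc q"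
    using zero_less_card_finite[where 'a = 'd] by (metis Suc_pred add_gr_0)
  obtain s where s: "\<forall>us :: (real ^ 'd \<Rightarrow> real) list. length us = Suc q \<longrightarrow>
     (\<forall>u\<in>set us. computable 4 1 u) \<longrightarrow> computable s (Suc q) (\<lambda>x. \<Prod>u\<leftarrow>us. u x)"
    using computable_prod_list ..
  let ?I = "SIGMA k:{..<n}. {is :: 'd list. length is = k}"
  have fin: "finite ?I" by auto
  obtain es :: "'d list" where es: "set es = UNIV" "distinct es"
    using finite_distinct_list[of "UNIV :: 'd set"] by auto
  then have len: "length es = CARD('d)"
    by (metis distinct_card)
  show ?thesis
  proof (intro exI[of _ "card ?I * s"] allI)
    fix p z c and m :: "'d \<Rightarrow> real"
    have "computable s (CARD('d) + n) (\<lambda>x :: real ^ 'd.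
        c is * ((\<Prod>i\<in>UNIV. hat (p * x $ i - m i)) * direction_monomial (x - z) is) + 0)"
      if "is": "length is = k" "k < n" for k "is"
    proof (rule computable_affine)
      let ?us = "map (\<lambda>i x :: real ^ 'd. hat (p * x $ i + - m i)) es @
        map (\<lambda>i x. x $ i + - (z $ i)) is @ replicate (n - k) (\<lambda>_. 1)"
      have "computable 4 1 (\<lambda>x :: real ^ 'd. x $ i - z $ i)" for i
        using computable_mono[OF computable_coordinate[of i "- z $ i"], of 4] by simp
      then have "\<forall>u\<in>set ?us. computable 4 1 u"
        using computable_hat[of p _ "- m _"] computable_mono[OF computable_const, of 4 1 1] by auto
      moreover have "length ?us = Suc q" using "is" len q by simp
      ultimately have "computable s (Suc q) (\<lambda>x. \<Prod>u\<leftarrow>?us. u x)"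
        using s by blast
      moreover have "(\<Prod>u\<leftarrow>?us. u x) = (\<Prod>i\<in>UNIV. hat (p * x $ i - m i)) * direction_monomial (x - z) is" for x
      proof -
        have "($) (x - z) = (\<lambda>i. x $ i - z $ i)"
          by (simp add: fun_eq_iff)
        then show ?thesis
          using prod.distinct_set_conv_list[OF es(2), of "\<lambda>i. hat (p * x $ i - m i)"]
          by (simp add: es(1) direction_monomial_def o_def)
      qed
      ultimately show "computable s (CARD('d) + n)
          (\<lambda>x. (\<Prod>i\<in>UNIV. hat (p * x $ i - m i)) * direction_monomial (x - z) is)"
        by (simp add: q)
    qed
    then have "computable (card ?I * s) (CARD('d) + n) (\<lambda>x :: real ^ 'd. \<Sum>j\<in>?I.
        c (snd j) * ((\<Prod>i\<in>UNIV. hat (p * x $ i - m i)) * direction_monomial (x - z) (snd j)) + 0)"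
      by (intro computable_sum[OF fin]) (auto simp: q)
    then show "computable (card ?I * s) (CARD('d) + n) (\<lambda>x :: real ^ 'd.
       (\<Prod>i\<in>UNIV. hat (p * x $ i - m i)) *
       (\<Sum>k<n. \<Sum>is | length is = k. c is * direction_monomial (x - z) is))"
    proof (rule computable_cong)
      fix x :: "real ^ 'd"
      have "(\<Sum>k<n. \<Sum>is | length is = k. c is * direction_monomial (x - z) is)
          = (\<Sum>(k, is)\<in>?I. c is * direction_monomial (x - z) is)"
        by (rule sum.Sigma) auto
      then show "(\<Prod>i\<in>UNIV. hat (p * x $ i - m i)) *
         (\<Sum>k<n. \<Sum>is | length is = k. c is * direction_monomial (x - z) is) =
         (\<Sum>j\<in>?I. c (snd j) * ((\<Prod>i\<in>UNIV. hat (p * x $ i - m i)) * direction_monomial (x - z) (snd j)) + 0)"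
        by (simp add: sum_distrib_left case_prod_beta mult_ac)
    qed
  qed
qed

text \<open>Taking the family instead of \<open>computable_sum\<close> keeps the fan-in at
  \<open>s\<close>, so that \<open>card J\<close> enters linearly and not squared.\<close>

lemma network_of_computable_sum:
  fixes g :: "'j \<Rightarrow> real ^ 'd::finite \<Rightarrow> real"
  assumes "finite J" "L \<ge> 1" "\<And>j. j \<in> J \<Longrightarrow> computable s L (g j)"
  obtains A a where "is_architecture CARD('d) A"
    "num_params A \<le> L * (card J * s * Suc s) + card J * s + 1"
    "\<And>x. x \<in> cbox 0 1 \<Longrightarrow> network A a x = (\<Sum>j\<in>J. g j x)"
proof -
  obtain F v where F: "neuron_chain relu_square L s F"
    and c: "\<And>l. 1 \<le> l \<Longrightarrow> l \<le> L \<Longrightarrow> card (F l) \<le> card J * s"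
    and v: "\<And>j. j \<in> J \<Longrightarrow> affine_comb (F L) (v j)"
      "\<And>j x. j \<in> J \<Longrightarrow> x \<in> cbox 0 1 \<Longrightarrow> g j x = v j x"
    using computable_family[where s = s and g = g, OF assms] by blast
  have aff: "affine_comb (F L) (\<lambda>x. \<Sum>j\<in>J. v j x)"
    by (rule affine_comb_sum[OF assms(1) v(1)])
  obtain A a where A: "is_architecture CARD('d) A"
    "num_params A \<le> (\<Sum>l<L. card (F (Suc l)) * Suc s) + card (F L) + 1"
    and net: "\<And>x. network A a x = (\<Sum>j\<in>J. v j x)"
    using network_of_neuron_chain[OF F aff] by blast
  have "(\<Sum>l<L. card (F (Suc l)) * Suc s) \<le> (\<Sum>l<L. card J * s * Suc s)"
    using c by (intro sum_mono mult_right_mono) auto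
  then have "num_params A \<le> L * (card J * s * Suc s) + card J * s + 1"
    using A(2) c[of L] assms(2) by simp
  moreover have "network A a x = (\<Sum>j\<in>J. g j x)" if "x \<in> cbox 0 1" for x
    using that v(2) by (simp add: net)
  ultimately show thesis using that A(1) by blast
qed

section \<open>The grid on the canonical subspaces\<close>

text \<open>For \<open>N > 0\<close> an index \<open>m\<close> stands for the point m / N, and the
  set describes the grid points in the canonical union.\<close>

definition grid :: "nat \<Rightarrow> nat \<Rightarrow> ('d::finite \<Rightarrow> nat) set" where
  "grid N k = (\<Union>e\<in>canonical_index k. {m. \<forall>i. m i \<le> (if i \<in> e then N else 0)})"

lemma grid_piece:
  "{m :: 'd::finite \<Rightarrow> nat. \<forall>i. m i \<le> (if i \<in> e then N else 0)}
    = (\<Pi>\<^sub>E i\<in>UNIV. {..if i \<in> e then N else 0})"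
  by (rule set_eqI) (simp add: PiE_iff split del: if_split)

lemma grid_le:
  assumes "m \<in> grid N k"
  shows "m i \<le> N"
proof -
  obtain e where "\<forall>i. m i \<le> (if i \<in> e then N else 0)"
    using assms unfolding grid_def by blast
  then have "m i \<le> (if i \<in> e then N else 0)" ..
  then show ?thesis by (cases "i \<in> e") simp_all
qed

lemma finite_grid: "finite (grid N k :: ('d::finite \<Rightarrow> nat) set)"
  unfolding grid_def grid_piece by (intro finite_UN_I finite_PiE) simp_all

text \<open>A union bound. The number of sets \<open>e\<close> is estimated by that of all subsets,
  which is uniform in \<open>k\<close>; points shared by several subspaces are simply counted
  repeatedly.\<close>

lemma card_grid_le: "card (grid N k :: ('d::finite \<Rightarrow> nat) set) \<le> 2 ^ CARD('d) * Suc N ^ k"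
proof -
  have card: "card {m :: 'd \<Rightarrow> nat. \<forall>i. m i \<le> (if i \<in> e then N else 0)} = Suc N ^ k"
    if "e \<in> canonical_index k" for e
  proof -
    have "card {m :: 'd \<Rightarrow> nat. \<forall>i. m i \<le> (if i \<in> e then N else 0)}
        = (\<Prod>i\<in>UNIV. Suc (if i \<in> e then N else 0))"
      unfolding grid_piece by (simp add: card_PiE)
    also have "\<dots> = (\<Prod>i\<in>e. Suc N)"
      by (rule prod.mono_neutral_cong_right) auto
    finally show ?thesis using that by (simp add: canonical_index_def)
  qed
  have "card (grid N k :: ('d \<Rightarrow> nat) set) \<le>
      (\<Sum>e\<in>canonical_index k. card {m :: 'd \<Rightarrow> nat. \<forall>i. m i \<le> (if i \<in> e then N else 0)})"
    unfolding grid_def by (rule card_UN_le) simp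
  also have "\<dots> = card (canonical_index k :: 'd set set) * Suc N ^ k"
    using card by simp
  also have "card (canonical_index k :: 'd set set) \<le> card (Pow (UNIV :: 'd set))"
    by (intro card_mono) auto
  also have "\<dots> = 2 ^ CARD('d)" by (rule card_Pow) simp
  finally show ?thesis by simp
qed

section \<open>The partition of unity by tensor hats\<close>

definition grid_hat :: "nat \<Rightarrow> ('d::finite \<Rightarrow> nat) \<Rightarrow> real ^ 'd \<Rightarrow> real" where
  "grid_hat N m x = (\<Prod>i\<in>UNIV. hat (real N * x $ i - real (m i)))"

lemma grid_hat_nonneg: "grid_hat N m x \<ge> 0"
  by (simp add: grid_hat_def hat_nonneg prod_nonneg)

lemma grid_hat_support:
  assumes "grid_hat N m x \<noteq> 0" "N > 0"
  shows "\<bar>x $ i - real (m i) / real N\<bar> \<le> 1 / real N"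
proof -
  have "hat (real N * x $ i - real (m i)) \<noteq> 0"
    using assms(1) by (simp add: grid_hat_def)
  then have "\<bar>real N * x $ i - real (m i)\<bar> < 1"
    by (meson hat_eq_0 not_le)
  moreover have "real N * x $ i - real (m i) = real N * (x $ i - real (m i) / real N)"
    using assms(2) by (simp add: right_diff_distrib)
  ultimately have "real N * \<bar>x $ i - real (m i) / real N\<bar> < 1"
    by (simp add: abs_mult)
  then show ?thesis
    using assms(2) by (simp add: pos_le_divide_eq mult.commute)
qed

text \<open>On the canonical subspace of \<open>e\<close> the hats of all multi-indices that are not supported in
  \<open>e\<close> vanish, so the full tensor partition of unity reduces to the grid.\<close>

lemma sum_grid_hat:
  fixes x :: "real ^ 'd::finite"
  assumes "x \<in> canonical_union k"
  shows "(\<Sum>m\<in>grid N k. grid_hat N m x) = 1"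
proof -
  obtain e where e: "e \<in> canonical_index k" "x \<in> canonical_subspace e"
    using assms unfolding canonical_union_def by blast
  then have x: "x \<in> cbox 0 1" "\<And>i. i \<notin> e \<Longrightarrow> x $ i = 0"
    by (auto simp: canonical_subspace_def)
  let ?full = "\<Pi>\<^sub>E i\<in>(UNIV :: 'd set). {..N}"
  have "(\<Sum>m\<in>grid N k. grid_hat N m x) = (\<Sum>m\<in>?full. grid_hat N m x)"
  proof (rule sum.mono_neutral_left)
    show "finite ?full" by (simp add: finite_PiE)
    show "grid N k \<subseteq> ?full"
      by (auto simp: PiE_iff intro: grid_le)
    show "\<forall>m\<in>?full - grid N k. grid_hat N m x = 0"
    proof
      fix m assume m: "m \<in> ?full - grid N k"
      then obtain i where "\<not> m i \<le> (if i \<in> e then N else 0)"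
        using e(1) unfolding grid_def by blast
      with m have i: "i \<notin> e" "m i \<ge> 1"
        by (auto simp: PiE_iff split: if_splits)
      then have "hat (real N * x $ i - real (m i)) = 0"
        using x(2) by (intro hat_eq_0) simp
      then show "grid_hat N m x = 0"
        unfolding grid_hat_def by (intro prod_zero) auto
    qed
  qed
  also have "\<dots> = (\<Prod>i\<in>UNIV. \<Sum>j\<le>N. hat (real N * x $ i - real j))"
    unfolding grid_hat_def by (rule prod_sum_PiE[symmetric]) auto
  also have "\<dots> = 1"
  proof (rule prod.neutral, rule ballI, rule sum_hat)
    fix i :: 'd
    have "0 \<le> x $ i" "x $ i \<le> 1" using x(1) by (auto simp: mem_box_cart)
    then show "0 \<le> real N * x $ i" "real N * x $ i \<le> real N"
      by (auto simp: mult_left_le)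
  qed
  finally show ?thesis .
qed

lemma canonical_union_subset: "canonical_union k \<subseteq> cbox 0 1"
  by (auto simp: canonical_union_def canonical_subspace_def)

text \<open>As the hats sum to 1, the error is a weighted average of local errors. A nonzero hat
  forces each coordinate of \<open>x\<close> to within 1 / N of the grid point, so the l1 distance
  is at most d / N.\<close>

lemma localized_approximation:
  fixes f :: "real ^ 'd::finite \<Rightarrow> real"
  assumes f: "continuous_on (cbox 0 1) f" "sobolev_norm n f \<le> 1" and "\<eta> > 0" "N > 0"
  obtains c where "\<And>x. x \<in> canonical_union k \<Longrightarrow>
    \<bar>f x - (\<Sum>m\<in>grid N k. grid_hat N m x * (\<Sum>l<n. \<Sum>is | length is = l. c m is *
        direction_monomial (x - (\<chi> i. real (m i) / real N)) is))\<bar>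
      \<le> \<eta> + (real CARD('d) / real N) ^ n"
proof -
  let ?z = "\<lambda>m. (\<chi> i. real (m i) / real N) :: real ^ 'd"
  let ?E = "\<eta> + (real CARD('d) / real N) ^ n"
  obtain c where c: "\<And>x z. x \<in> cbox 0 1 \<Longrightarrow> z \<in> cbox 0 1 \<Longrightarrow>
    \<bar>f x - (\<Sum>k<n. \<Sum>is | length is = k. c is z * direction_monomial (x - z) is)\<bar>
      \<le> \<eta> + (\<Sum>i\<in>UNIV. \<bar>x $ i - z $ i\<bar>) ^ n"
    using local_polynomial_approximation[OF f \<open>\<eta> > 0\<close>] by blast
  let ?P = "\<lambda>m x. \<Sum>l<n. \<Sum>is | length is = l. c is (?z m) * direction_monomial (x - ?z m) is"
  have "\<bar>f x - (\<Sum>m\<in>grid N k. grid_hat N m x * ?P m x)\<bar> \<le> ?E" if x: "x \<in> canonical_union k" for x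
  proof -
    have cube: "x \<in> cbox 0 1" using x canonical_union_subset by blast
    have "grid_hat N m x * \<bar>f x - ?P m x\<bar> \<le> grid_hat N m x * ?E" if m: "m \<in> grid N k" for m
    proof (cases "grid_hat N m x = 0")
      case False
      have "m i \<le> N" for i
        using m by (rule grid_le)
      then have "?z m \<in> cbox 0 1"
        using \<open>N > 0\<close> by (simp add: mem_box_cart)
      moreover have "(\<Sum>i\<in>UNIV. \<bar>x $ i - ?z m $ i\<bar>) ^ n \<le> (real CARD('d) / real N) ^ n"
      proof (rule power_mono)
        have "(\<Sum>i\<in>UNIV. \<bar>x $ i - ?z m $ i\<bar>) \<le> (\<Sum>i\<in>(UNIV :: 'd set). 1 / real N)"
          using grid_hat_support[OF False \<open>N > 0\<close>] by (intro sum_mono) simp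
        then show "(\<Sum>i\<in>UNIV. \<bar>x $ i - ?z m $ i\<bar>) \<le> real CARD('d) / real N" by simp
      qed (simp add: sum_nonneg)
      ultimately have "\<bar>f x - ?P m x\<bar> \<le> ?E"
        using c[OF cube, of "?z m"] by linarith
      then show ?thesis
        by (rule mult_left_mono) (rule grid_hat_nonneg)
    qed simp
    then have le: "(\<Sum>m\<in>grid N k. grid_hat N m x * \<bar>f x - ?P m x\<bar>) \<le> (\<Sum>m\<in>grid N k. grid_hat N m x * ?E)"
      by (rule sum_mono)
    have "f x = (\<Sum>m\<in>grid N k. grid_hat N m x) * f x"
      by (simp add: sum_grid_hat[OF x])
    then have "f x - (\<Sum>m\<in>grid N k. grid_hat N m x * ?P m x)
        = (\<Sum>m\<in>grid N k. grid_hat N m x * (f x - ?P m x))"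
      by (simp add: sum_distrib_right right_diff_distrib sum_subtractf)
    also have "\<bar>\<dots>\<bar> \<le> (\<Sum>m\<in>grid N k. grid_hat N m x * \<bar>f x - ?P m x\<bar>)"
      by (rule order_trans[OF sum_abs]) (simp add: abs_mult grid_hat_nonneg)
    also have "\<dots> \<le> (\<Sum>m\<in>grid N k. grid_hat N m x * ?E)" by (rule le)
    also have "\<dots> = ?E"
      by (simp add: sum_distrib_right[symmetric] sum_grid_hat[OF x])
    finally show ?thesis .
  qed
  then show thesis using that[of "\<lambda>m is. c is (?z m)"] by blast
qed

section \<open>Choice of the mesh and the final count\<close>

lemma grid_size:
  fixes \<epsilon> :: real and d n :: nat
  assumes "d \<ge> 1" "n \<ge> 1" "0 < \<epsilon>" "\<epsilon> < 1"
  obtains N :: nat where "N > 0" "(real d / real N) ^ n \<le> \<epsilon> / 2"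
    "\<And>k. k \<le> d \<Longrightarrow> real (Suc N) ^ k \<le> (6 * real d) ^ d * \<epsilon> powr (- (real k / real n))"
proof -
  \<comment> \<open>Once N is at least d * y, the Taylor error (d / N) ^ n is at most 1 / y ^ n,
    that is \<epsilon> / 2.\<close>
  define y where "y = (2 / \<epsilon>) powr (1 / real n)"
  have y: "y \<ge> 1" "y ^ n = 2 / \<epsilon>"
    using assms unfolding y_def by (auto simp: ge_one_powr_ge_zero powr_realpow[symmetric] powr_powr)
  define N where "N = nat \<lceil>real d * y\<rceil>"
  have dy: "real d * y \<ge> 1" using assms(1) y(1) by (metis mult_ge1_I of_nat_1 of_nat_mono)
  have N: "real N \<ge> real d * y" "real N < real d * y + 1"
    using dy unfolding N_def by linarith+
  have "N > 0" using N(1) dy by (cases N) auto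
  moreover have "(real d / real N) ^ n \<le> \<epsilon> / 2"
  proof -
    have "real d / real N \<le> 1 / y"
      using N(1) y(1) \<open>N > 0\<close> by (simp add: divide_simps mult.commute)
    then have "(real d / real N) ^ n \<le> (1 / y) ^ n"
      by (intro power_mono) auto
    then show ?thesis by (simp add: power_one_over y(2))
  qed
  moreover have "real (Suc N) ^ k \<le> (6 * real d) ^ d * \<epsilon> powr (- (real k / real n))" if "k \<le> d" for k
  proof -
    define w where "w = \<epsilon> powr (- (1 / real n))"
    have "y = 2 powr (1 / real n) * w"
      using assms unfolding y_def w_def by (simp add: powr_divide powr_minus_divide)
    moreover have "2 powr (1 / real n) \<le> 2 powr 1"
      using assms(2) by (intro powr_mono) auto
    moreover have "w > 0" using assms by (simp add: w_def)
    ultimately have yw: "y \<le> 2 * w" by simp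
    \<comment> \<open>The factor 3 comes from N + 1 < d * y + 2 and d * y \<ge> 1; with y \<le> 2 *
      w it becomes the 6 of the bound.\<close>
    have "real (Suc N) \<le> 3 * (real d * y)" using N(2) dy by simp
    also have "\<dots> \<le> 3 * (real d * (2 * w))"
      using yw by (intro mult_left_mono) auto
    also have "\<dots> = 6 * real d * w" by simp
    finally have "real (Suc N) ^ k \<le> (6 * real d * w) ^ k"
      by (rule power_mono) simp
    also have "\<dots> = (6 * real d) ^ k * w ^ k" by (rule power_mult_distrib)
    \<comment> \<open>The base is at least 1, so raising the exponent from k to d is harmless and
      makes the constant independent of k.\<close>
    also have "\<dots> \<le> (6 * real d) ^ d * w ^ k"
      using assms(1) that \<open>w > 0\<close> by (intro mult_right_mono power_increasing) auto
    also have "w ^ k = \<epsilon> powr (- (real k / real n))"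
      using assms unfolding w_def by (simp add: powr_realpow[symmetric] powr_powr)
    finally show ?thesis .
  qed
  ultimately show thesis using that by blast
qed

theorem theorem1p5:
  fixes n :: nat
  assumes "n \<ge> 1"
  shows "\<exists>C5 > 0. \<forall>d_eff :: nat. 1 \<le> d_eff \<longrightarrow> d_eff < CARD('d::finite) \<longrightarrow>
    (\<forall>\<epsilon> :: real. 0 < \<epsilon> \<longrightarrow> \<epsilon> < 1 \<longrightarrow>
      (\<forall>f :: real ^ 'd \<Rightarrow> real. continuous_on (cbox 0 1) f \<longrightarrow> sobolev_norm n f \<le> 1 \<longrightarrow>
        (\<exists>A. is_architecture CARD('d) A \<and>
             real (num_params A) \<le> C5 * \<epsilon> powr (- (real d_eff / real n)) \<and>
             (\<exists>a. \<forall>x \<in> canonical_union d_eff. \<bar>f x - network A a x\<bar> \<le> \<epsilon>))))"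
proof -
  let ?d = "CARD('d)"
  obtain s where s: "\<forall>p (m :: 'd \<Rightarrow> real) z c. computable s (?d + n) (\<lambda>x :: real ^ 'd.
     (\<Prod>i\<in>UNIV. hat (p * x $ i - m i)) *
     (\<Sum>k<n. \<Sum>is | length is = k. c is * direction_monomial (x - z) is))"
    using computable_localized_polynomial ..
  \<comment> \<open>Parameters per grid point: d + n layers of at most \<open>s\<close> neurons with
    \<open>s\<close> weights and a bias each, plus \<open>s\<close> output weights. \<open>B\<close>
    will bound the number of grid points up to the power of \<epsilon>.\<close>
  define K where "K = real ((?d + n) * (s * Suc s) + s)"
  define B where "B = 2 ^ ?d * (6 * real ?d) ^ ?d"
  have B: "B > 0" and K: "K \<ge> 0" by (auto simp: B_def K_def)
  show ?thesis
  proof (intro exI[of _ "K * B + 1"] conjI allI impI)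
    show "K * B + 1 > 0" using B K by (simp add: add_nonneg_pos)
    fix k :: nat and \<epsilon> :: real and f :: "real ^ 'd \<Rightarrow> real"
    assume k: "1 \<le> k" "k < ?d" and \<epsilon>: "0 < \<epsilon>" "\<epsilon> < 1"
      and f: "continuous_on (cbox 0 1) f" "sobolev_norm n f \<le> 1"
    obtain N where N: "N > 0" "(real ?d / real N) ^ n \<le> \<epsilon> / 2"
      and Nk: "\<And>k. k \<le> ?d \<Longrightarrow> real (Suc N) ^ k \<le> (6 * real ?d) ^ ?d * \<epsilon> powr (- (real k / real n))"
      using grid_size[OF _ assms \<epsilon>, of ?d] by (auto simp: Suc_le_eq)
    \<comment> \<open>The error is split evenly between mollification and Taylor remainder.\<close>
    obtain c where c: "\<And>x. x \<in> canonical_union k \<Longrightarrow>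
      \<bar>f x - (\<Sum>m\<in>grid N k. grid_hat N m x * (\<Sum>l<n. \<Sum>is | length is = l. c m is *
          direction_monomial (x - (\<chi> i. real (m i) / real N)) is))\<bar>
        \<le> \<epsilon> / 2 + (real ?d / real N) ^ n"
      using localized_approximation[OF f _ N(1), of "\<epsilon> / 2" k] \<epsilon> by auto
    define g where "g m x = grid_hat N m x * (\<Sum>l<n. \<Sum>is | length is = l. c m is *
          direction_monomial (x - (\<chi> i. real (m i) / real N)) is)" for m x
    have "computable s (?d + n) (g m)" for m
      unfolding g_def grid_hat_def using s[rule_format, of "real N" "\<lambda>i. real (m i)"] by simp
    then have comp: "computable s (?d + n) (g m)" if "m \<in> grid N k" for m .
    obtain A a where A: "is_architecture ?d A"
      "num_params A \<le> (?d + n) * (card (grid N k :: ('d \<Rightarrow> nat) set) * s * Suc s)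
         + card (grid N k :: ('d \<Rightarrow> nat) set) * s + 1"
      and net: "\<And>x. x \<in> cbox 0 1 \<Longrightarrow> network A a x = (\<Sum>m\<in>grid N k. g m x)"
      using network_of_computable_sum[where J = "grid N k" and L = "?d + n" and s = s and g = g,
          OF finite_grid trans_le_add2[OF assms] comp] by blast
    have "real (num_params A) \<le> (K * B + 1) * \<epsilon> powr (- (real k / real n))"
    proof -
      let ?e = "\<epsilon> powr (- (real k / real n))"
      \<comment> \<open>The output bias contributes a single parameter; this estimate absorbs it and
        explains the + 1 in the constant.\<close>
      have e1: "?e \<ge> 1"
        using powr_mono'[of "- (real k / real n)" 0 \<epsilon>] \<epsilon> by simp
      have "real (card (grid N k :: ('d \<Rightarrow> nat) set)) \<le> 2 ^ ?d * real (Suc N) ^ k"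
        using of_nat_mono[OF card_grid_le[of N k, where 'd = 'd], where 'a = real] by simp
      also have "\<dots> \<le> 2 ^ ?d * ((6 * real ?d) ^ ?d * ?e)"
        using Nk[of k] k(2) by (intro mult_left_mono) auto
      finally have card: "real (card (grid N k :: ('d \<Rightarrow> nat) set)) \<le> B * ?e"
        by (simp add: B_def)
      have "real (num_params A) \<le> K * real (card (grid N k :: ('d \<Rightarrow> nat) set)) + 1"
        using A(2)[THEN of_nat_mono, where 'a = real] by (simp add: K_def algebra_simps)
      also have "\<dots> \<le> K * (B * ?e) + ?e"
        using card K e1 by (intro add_mono mult_left_mono)
      finally show ?thesis by (simp add: algebra_simps)
    qed
    moreover have "\<bar>f x - network A a x\<bar> \<le> \<epsilon>" if "x \<in> canonical_union k" for x
    proof -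
      have "network A a x = (\<Sum>m\<in>grid N k. g m x)"
        using that canonical_union_subset by (intro net) blast
      then show ?thesis
        using c[OF that] N(2) by (simp add: g_def)
    qed
    ultimately show "\<exists>A. is_architecture ?d A \<and>
        real (num_params A) \<le> (K * B + 1) * \<epsilon> powr (- (real k / real n)) \<and>
        (\<exists>a. \<forall>x\<in>canonical_union k. \<bar>f x - network A a x\<bar> \<le> \<epsilon>)"
      using A(1) by blast
  qed
qed

end
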